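(* There is a universal constant $C$ and a randomized algorithm such that the following holds. Let $g:\{\pm1\}^n\to\mathbb{R}$ be a given polynomial of degree at most $k$ with $\mathrm{Var}[g]=1$. Let $t\geq 1$ and suppose $\mathrm{Inf}_i[g]\leq C^{-k}t^{-2}$ for all $i\in[n]$. Then with high probability the algorithm outputs an assignment $x\in\{\pm1\}^n$ with $|g(x)|\geq t$. The running time of the algorithm is $\mathrm{poly}(m,n,\exp(k))$, where $m$ is the number of nonzero monomials of $g$ (assuming exact real arithmetic can be performed efficiently).
   Context: Every $g:\{\pm1\}^n\to\mathbb{R}$ has a unique multilinear (Fourier) expansion $g(x)=\sum_{S\subseteq[n]}\hat g(S)\prod_{i\in S}x_i$; its degree is the maximum $|S|$ with $\hat g(S)\neq 0$. Variance is with respect to uniform $\boldsymbol{x}\in\{\pm1\}^n$, so $\mathrm{Var}[g]=\sum_{S\neq\emptyset}\hat g(S)^2$. The influence of coordinate $i$ is $\mathrm{Inf}_i[g]=\sum_{S\ni i}\hat g(S)^2$. *)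

theory Defs
  imports "HOL-Probability.Probability" "HOL-Library.More_List"
begin

section \<open>Fourier analysis on the discrete cube\<close>

text \<open>
  Coordinates are numbered \<open>0, \<dots>, n - 1\<close>. Points of \<open>{\<plusminus>1}\<^sup>n\<close> are extensional functions, and only
  the values of \<open>g\<close> on \<open>cube n\<close> matter.
\<close>

definition cube :: "nat \<Rightarrow> (nat \<Rightarrow> real) set" where
  "cube n = {..<n} \<rightarrow>\<^sub>E {-1, 1}"

definition is_multilinear_expansion ::
    "nat \<Rightarrow> ((nat \<Rightarrow> real) \<Rightarrow> real) \<Rightarrow> (nat set \<Rightarrow> real) \<Rightarrow> bool" where
  "is_multilinear_expansion n g c \<longleftrightarrow>
     (\<forall>S. \<not> S \<subseteq> {..<n} \<longrightarrow> c S = 0) \<and>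
     (\<forall>x\<in>cube n. g x = (\<Sum>S\<in>Pow {..<n}. c S * (\<Prod>i\<in>S. x i)))"

text \<open>Existence and uniqueness are proved in \<open>multilinear_expansion_unique\<close> below.\<close>

definition fourier_coeff :: "nat \<Rightarrow> ((nat \<Rightarrow> real) \<Rightarrow> real) \<Rightarrow> nat set \<Rightarrow> real" where
  "fourier_coeff n g = (THE c. is_multilinear_expansion n g c)"

definition fourier_support :: "nat \<Rightarrow> ((nat \<Rightarrow> real) \<Rightarrow> real) \<Rightarrow> nat set set" where
  "fourier_support n g = {S. S \<subseteq> {..<n} \<and> fourier_coeff n g S \<noteq> 0}"

text \<open>The inserted \<open>0\<close> only serves to give the zero function degree \<open>0\<close>.\<close>

definition fourier_degree :: "nat \<Rightarrow> ((nat \<Rightarrow> real) \<Rightarrow> real) \<Rightarrow> nat" where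
  "fourier_degree n g = Max (insert 0 (card ` fourier_support n g))"

definition cube_variance :: "nat \<Rightarrow> ((nat \<Rightarrow> real) \<Rightarrow> real) \<Rightarrow> real" where
  "cube_variance n g = measure_pmf.variance (pmf_of_set (cube n)) g"

definition influence :: "nat \<Rightarrow> ((nat \<Rightarrow> real) \<Rightarrow> real) \<Rightarrow> nat \<Rightarrow> real" where
  "influence n g i = (\<Sum>S | S \<subseteq> {..<n} \<and> i \<in> S. (fourier_coeff n g S)\<^sup>2)"

lemma finite_cube: "finite (cube n)"
  unfolding cube_def by (intro finite_PiE) auto

lemma card_cube: "card (cube n) = 2 ^ n"
  unfolding cube_def by (subst card_PiE) (auto simp: numeral_2_eq_2)

lemma cube_nonempty: "cube n \<noteq> {}"
  using card_cube[of n] by force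

lemma cube_square: "x \<in> cube n \<Longrightarrow> i < n \<Longrightarrow> x i * x i = 1"
  unfolding cube_def by (fastforce dest: PiE_mem)

lemma character_orthogonality:
  assumes "S \<subseteq> {..<n}" "T \<subseteq> {..<n}"
  shows "(\<Sum>x\<in>cube n. (\<Prod>i\<in>S. x i) * (\<Prod>i\<in>T. x i)) = (if S = T then 2 ^ n else 0)"
proof -
  let ?f = "\<lambda>i (v :: real). (if i \<in> S then v else 1) * (if i \<in> T then v else 1)"
  have expand: "(\<Prod>i\<in>U. x i) = (\<Prod>i<n. if i \<in> U then x i else 1)"
    if "U \<subseteq> {..<n}" for U and x :: "nat \<Rightarrow> real"
    using that by (simp add: prod.If_cases Int_absorb1)
  have "(\<Sum>x\<in>cube n. (\<Prod>i\<in>S. x i) * (\<Prod>i\<in>T. x i)) = (\<Sum>x\<in>cube n. \<Prod>i<n. ?f i (x i))"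
    by (simp only: expand[OF assms(1)] expand[OF assms(2)] prod.distrib)
  also have "\<dots> = (\<Prod>i<n. \<Sum>v\<in>{-1, 1}. ?f i v)"
    unfolding cube_def by (rule prod_sum_PiE[symmetric]) auto
  also have "\<dots> = (\<Prod>i<n. if i \<in> S \<longleftrightarrow> i \<in> T then 2 else 0)"
    by (intro prod.cong) auto
  also have "\<dots> = (if S = T then 2 ^ n else 0)"
  proof (cases "S = T")
    case False
    then obtain i where "i < n" "\<not> (i \<in> S \<longleftrightarrow> i \<in> T)"
      using assms by blast
    then show ?thesis
      using False by (auto intro!: prod_zero)
  qed simp
  finally show ?thesis .
qed

lemma character_sum:
  assumes "x \<in> cube n" "y \<in> cube n"
  shows "(\<Sum>S\<in>Pow {..<n}. (\<Prod>i\<in>S. x i) * (\<Prod>i\<in>S. y i)) = (if x = y then 2 ^ n else 0)"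
proof -
  have "(\<Sum>S\<in>Pow {..<n}. (\<Prod>i\<in>S. x i) * (\<Prod>i\<in>S. y i)) = (\<Prod>i<n. x i * y i + 1)"
    by (subst prod_add) (simp_all add: prod.distrib)
  also have "\<dots> = (if x = y then 2 ^ n else 0)"
  proof (cases "x = y")
    case True
    then show ?thesis
      using cube_square[OF assms(1)] by simp
  next
    case False
    then obtain i where i: "i < n" "x i \<noteq> y i"
      using PiE_ext[of x "{..<n}" "\<lambda>_. {-1, 1}" y] assms unfolding cube_def by auto
    moreover have "x i \<in> {-1, 1}" "y i \<in> {-1, 1}"
      using assms i(1) unfolding cube_def by (auto dest: PiE_mem)
    ultimately show ?thesis
      using False by (auto intro!: prod_zero bexI[of _ i])
  qed
  finally show ?thesis .
qed

lemma multilinear_expansion_coeff: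
  assumes "is_multilinear_expansion n g c" "T \<subseteq> {..<n}"
  shows "c T = (\<Sum>x\<in>cube n. g x * (\<Prod>i\<in>T. x i)) / 2 ^ n"
proof -
  have "(\<Sum>x\<in>cube n. g x * (\<Prod>i\<in>T. x i)) =
      (\<Sum>x\<in>cube n. \<Sum>S\<in>Pow {..<n}. c S * ((\<Prod>i\<in>S. x i) * (\<Prod>i\<in>T. x i)))"
    using assms(1) unfolding is_multilinear_expansion_def
    by (intro sum.cong) (auto simp: sum_distrib_right mult.assoc)
  also have "\<dots> = (\<Sum>S\<in>Pow {..<n}. c S * (\<Sum>x\<in>cube n. (\<Prod>i\<in>S. x i) * (\<Prod>i\<in>T. x i)))"
    by (subst sum.swap) (simp add: sum_distrib_left)
  also have "\<dots> = (\<Sum>S\<in>Pow {..<n}. if S = T then c S * 2 ^ n else 0)"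
    using assms(2) by (intro sum.cong) (auto simp: character_orthogonality)
  also have "\<dots> = c T * 2 ^ n"
    using assms(2) by (simp add: sum.delta)
  finally show ?thesis by simp
qed

lemma multilinear_expansion_exists: "\<exists>c. is_multilinear_expansion n g c"
proof
  let ?c = "\<lambda>S. if S \<subseteq> {..<n} then (\<Sum>y\<in>cube n. g y * (\<Prod>i\<in>S. y i)) / 2 ^ n else 0"
  have "g x = (\<Sum>S\<in>Pow {..<n}. ?c S * (\<Prod>i\<in>S. x i))" if x: "x \<in> cube n" for x
  proof -
    have "(\<Sum>S\<in>Pow {..<n}. ?c S * (\<Prod>i\<in>S. x i)) =
        (\<Sum>S\<in>Pow {..<n}. \<Sum>y\<in>cube n. g y / 2 ^ n * ((\<Prod>i\<in>S. y i) * (\<Prod>i\<in>S. x i)))"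
      by (intro sum.cong) (auto simp: sum_divide_distrib sum_distrib_left mult_ac)
    also have "\<dots> =
        (\<Sum>y\<in>cube n. g y / 2 ^ n * (\<Sum>S\<in>Pow {..<n}. (\<Prod>i\<in>S. y i) * (\<Prod>i\<in>S. x i)))"
      by (subst sum.swap) (simp add: sum_distrib_left)
    also have "\<dots> = (\<Sum>y\<in>cube n. if y = x then g y else 0)"
      using x by (intro sum.cong) (auto simp: character_sum)
    also have "\<dots> = g x"
      using x by (simp add: sum.delta finite_cube)
    finally show ?thesis by simp
  qed
  then show "is_multilinear_expansion n g ?c"
    unfolding is_multilinear_expansion_def by simp
qed

lemma multilinear_expansion_unique: "\<exists>!c. is_multilinear_expansion n g c"
proof (rule ex_ex1I[OF multilinear_expansion_exists])
  fix c d
  assume cd: "is_multilinear_expansion n g c" "is_multilinear_expansion n g d"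
  show "c = d"
  proof
    fix S
    show "c S = d S"
    proof (cases "S \<subseteq> {..<n}")
      case True
      then show ?thesis
        using cd by (simp add: multilinear_expansion_coeff)
    next
      case False
      then show ?thesis
        using cd unfolding is_multilinear_expansion_def by simp
    qed
  qed
qed

lemma fourier_coeff_expansion: "is_multilinear_expansion n g (fourier_coeff n g)"
  unfolding fourier_coeff_def by (rule theI'[OF multilinear_expansion_unique])


section \<open>Randomized algorithms with exact real arithmetic\<close>

text \<open>
  The model is a real RAM with fair coins, presented as a while language. A program uses finitely
  many arrays of natural numbers and finitely many arrays of reals; an array is named by a number
  that is fixed in the program text, is indexed by computed natural numbers, and is unbounded.
  Real cells support exact field operations and comparisons. There is no conversion from
  reals to naturals (no rounding) and no multiplication of naturals: with these, unit-cost
  arithmetic would be unreasonably powerful. Subtraction of naturals is truncated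
  and division by zero yields zero, as in HOL.
\<close>

datatype nexp =
    NConst nat
  | NRead nat nexp
  | NAdd nexp nexp
  | NSub nexp nexp

datatype rexp =
    RConst int
  | RRead nat nexp
  | RAdd rexp rexp
  | RSub rexp rexp
  | RMul rexp rexp
  | RDiv rexp rexp

datatype bexp =
    NLess nexp nexp
  | RLess rexp rexp
  | BNot bexp
  | BAnd bexp bexp

datatype com =
    Skip
  | NWrite nat nexp nexp
  | RWrite nat nexp rexp
  | Flip nat nexp
  | Seq com com
  | If bexp com com
  | While bexp com

record state =
  narr :: "nat \<Rightarrow> nat \<Rightarrow> nat"
  rarr :: "nat \<Rightarrow> nat \<Rightarrow> real"

primrec nval :: "nexp \<Rightarrow> state \<Rightarrow> nat" where
  "nval (NConst k) s = k"
| "nval (NRead a e) s = narr s a (nval e s)"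
| "nval (NAdd e f) s = nval e s + nval f s"
| "nval (NSub e f) s = nval e s - nval f s"

primrec rval :: "rexp \<Rightarrow> state \<Rightarrow> real" where
  "rval (RConst z) s = of_int z"
| "rval (RRead a e) s = rarr s a (nval e s)"
| "rval (RAdd e f) s = rval e s + rval f s"
| "rval (RSub e f) s = rval e s - rval f s"
| "rval (RMul e f) s = rval e s * rval f s"
| "rval (RDiv e f) s = rval e s / rval f s"

primrec bval :: "bexp \<Rightarrow> state \<Rightarrow> bool" where
  "bval (NLess e f) s \<longleftrightarrow> nval e s < nval f s"
| "bval (RLess e f) s \<longleftrightarrow> rval e s < rval f s"
| "bval (BNot b) s \<longleftrightarrow> \<not> bval b s"
| "bval (BAnd b b') s \<longleftrightarrow> bval b s \<and> bval b' s"

definition nwrite :: "nat \<Rightarrow> nat \<Rightarrow> nat \<Rightarrow> state \<Rightarrow> state" where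
  "nwrite a i v s = s\<lparr>narr := (narr s)(a := (narr s a)(i := v))\<rparr>"

definition rwrite :: "nat \<Rightarrow> nat \<Rightarrow> real \<Rightarrow> state \<Rightarrow> state" where
  "rwrite a i v s = s\<lparr>rarr := (rarr s)(a := (rarr s a)(i := v))\<rparr>"

text \<open>
  One machine step. Expressions occur literally in the program, so evaluating one costs a
  constant depending only on the program and is counted as part of the step.
\<close>

primrec step :: "com \<Rightarrow> state \<Rightarrow> (com \<times> state) pmf" where
  "step Skip s = return_pmf (Skip, s)"
| "step (NWrite a e f) s = return_pmf (Skip, nwrite a (nval e s) (nval f s) s)"
| "step (RWrite a e f) s = return_pmf (Skip, rwrite a (nval e s) (rval f s) s)"
| "step (Flip a e) s = map_pmf (\<lambda>v. (Skip, nwrite a (nval e s) v s)) (pmf_of_set {0, 1})"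
| "step (Seq c d) s =
     (if c = Skip then return_pmf (d, s)
      else map_pmf (\<lambda>(c', s'). (Seq c' d, s')) (step c s))"
| "step (If b c d) s = return_pmf (if bval b s then c else d, s)"
| "step (While b c) s = return_pmf (If b (Seq c (While b c)) Skip, s)"

primrec run :: "nat \<Rightarrow> com \<times> state \<Rightarrow> (com \<times> state) pmf" where
  "run 0 cfg = return_pmf cfg"
| "run (Suc T) cfg = bind_pmf (step (fst cfg) (snd cfg)) (run T)"

text \<open>Running time is worst case over all outcomes of the coins.\<close>

definition halts_within :: "com \<Rightarrow> state \<Rightarrow> nat \<Rightarrow> bool" where
  "halts_within A s T \<longleftrightarrow> (\<forall>cfg\<in>set_pmf (run T (A, s)). fst cfg = Skip)"

definition halts :: "com \<Rightarrow> state \<Rightarrow> bool" where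
  "halts A s \<longleftrightarrow> (\<exists>T. halts_within A s T)"

definition running_time :: "com \<Rightarrow> state \<Rightarrow> nat" where
  "running_time A s = (LEAST T. halts_within A s T)"

text \<open>The distribution of the final state; meaningful if \<open>halts A s\<close>.\<close>

definition final_state :: "com \<Rightarrow> state \<Rightarrow> state pmf" where
  "final_state A s = map_pmf snd (run (running_time A s) (A, s))"


section \<open>Input and output format\<close>

text \<open>
  A polynomial is given as a list of its nonzero monomials, in any order. The array of naturals 0
  holds \<open>n\<close> and the number of monomials. The array of naturals 1 holds, for each monomial in turn,
  its size followed by its variables in increasing order. The array of reals 0 holds the
  coefficients. Everything else is initially zero.
\<close>

definition lists_monomials :: "nat \<Rightarrow> ((nat \<Rightarrow> real) \<Rightarrow> real) \<Rightarrow> nat set list \<Rightarrow> bool" where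
  "lists_monomials n g Ss \<longleftrightarrow> distinct Ss \<and> set Ss = fourier_support n g"

definition input_state :: "nat \<Rightarrow> ((nat \<Rightarrow> real) \<Rightarrow> real) \<Rightarrow> nat set list \<Rightarrow> state" where
  "input_state n g Ss =
     \<lparr> narr = (\<lambda>_ _. 0)
         (0 := nth_default 0 [n, length Ss],
          1 := nth_default 0 (concat (map (\<lambda>S. card S # sorted_list_of_set S) Ss))),
       rarr = (\<lambda>_ _. 0)(0 := nth_default 0 (map (fourier_coeff n g) Ss)) \<rparr>"

text \<open>The output is read off the first \<open>n\<close> cells of the array of reals 1.\<close>

definition output_point :: "nat \<Rightarrow> state \<Rightarrow> nat \<Rightarrow> real" where
  "output_point n s = restrict (rarr s 1) {..<n}"

end

theory Submission
  imports Defs "HOL-Computational_Algebra.Polynomial" "HOL-Real_Asymp.Real_Asymp"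
begin

text \<open>
  Identify \<open>g\<close> with its multilinear extension to \<open>[-1, 1]\<^sup>n\<close>. At \<open>w = z / 2\<close> for a random
  \<open>z \<in> {\<plusminus>1}\<^sup>n\<close>, the partial derivatives \<open>\<partial>\<^sub>i g(w)\<close> are low-degree polynomials of \<open>z\<close> with second
  moment at least \<open>4\<^sup>-\<^sup>k Inf\<^sub>i[g]\<close>. By Bonami's lemma and a Paley-Zygmund argument,
  \<open>\<Sum>\<^sub>i \<bar>\<partial>\<^sub>i g(w)\<bar>\<close> is at least \<open>exp(-O(k)) \<Sum>\<^sub>i Inf\<^sub>i[g]\<^sup>1\<^sup>/\<^sup>2\<close> with probability \<open>exp(-O(k))\<close>, and since
  all influences are small but sum to at least 1, this is a large multiple of \<open>t\<close>. It is the linear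
  coefficient of \<open>\<delta> \<mapsto> g(w + \<delta> s)\<close>, where \<open>s\<close> is the sign vector of the gradient, a polynomial of
  degree at most \<open>k\<close>; eliminating the other coefficients one by one from its values at
  \<open>\<delta> = 2\<^sup>-\<^sup>1, \<dots>, 2\<^sup>-\<^sup>k\<^sup>-\<^sup>1\<close> shows that \<open>\<bar>g\<bar> \<ge> t\<close> at one of these points. As \<open>g\<close> is affine in each
  coordinate, the point can be rounded coordinate by coordinate to a vertex without decreasing
  \<open>\<bar>g\<bar>\<close>. The influence bound also forces \<open>n \<ge> C\<^sup>k\<close>, so \<open>n\<close> independent trials suffice, and the
  algorithm need not know \<open>k\<close> or \<open>t\<close>.
\<close>

section \<open>Quantitative Hoare logic for randomized programs\<close>

lemma run_Skip: "run T (Skip, s) = return_pmf (Skip, s)"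
  by (induction T) (auto simp: bind_return_pmf)

lemma run_add: "run (T + T') cfg = bind_pmf (run T cfg) (run T')"
proof (induction T arbitrary: cfg)
  case (Suc T)
  then have "run (T + T') = (\<lambda>cfg. bind_pmf (run T cfg) (run T'))" by blast
  then show ?case by (simp add: bind_assoc_pmf)
qed (simp add: bind_return_pmf)

lemma run_halted:
  assumes "halts_within c s T" "T \<le> T'"
  shows "run T' (c, s) = run T (c, s)"
proof -
  have "run T' (c, s) = bind_pmf (run T (c, s)) (run (T' - T))"
    using run_add[of T "T' - T"] assms(2) by simp
  also have "\<dots> = bind_pmf (run T (c, s)) return_pmf"
    using assms(1) by (intro bind_pmf_cong refl) (auto simp: halts_within_def run_Skip split_paired_all)
  finally show ?thesis by (simp add: bind_return_pmf')
qed

lemma halts_within_mono: "halts_within c s T \<Longrightarrow> T \<le> T' \<Longrightarrow> halts_within c s T'"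
  using run_halted[of c s T T'] by (simp add: halts_within_def)

lemma running_time_le: "halts_within c s T \<Longrightarrow> running_time c s \<le> T"
  unfolding running_time_def by (rule Least_le)

lemma final_state_eq: "halts_within c s T \<Longrightarrow> final_state c s = map_pmf snd (run T (c, s))"
proof -
  assume h: "halts_within c s T"
  then have "halts_within c s (running_time c s)"
    unfolding running_time_def by (rule LeastI)
  with h show ?thesis
    unfolding final_state_def using run_halted running_time_le by metis
qed

lemma halts_within_iff: "halts_within c s (Suc T) \<longleftrightarrow> (\<forall>(c', s')\<in>set_pmf (step c s). halts_within c' s' T)"
  by (auto simp: halts_within_def)

lemma final_state_step:
  assumes "halts_within c s (Suc T)"
  shows "final_state c s = bind_pmf (step c s) (\<lambda>(c', s'). final_state c' s')"
proof -
  have "final_state c s = bind_pmf (step c s) (\<lambda>cfg. map_pmf snd (run T cfg))"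
    by (simp add: final_state_eq[OF assms] map_bind_pmf)
  also have "\<dots> = bind_pmf (step c s) (\<lambda>(c', s'). final_state c' s')"
    using assms by (intro bind_pmf_cong refl) (auto simp: halts_within_iff final_state_eq)
  finally show ?thesis .
qed

lemma halts_within_Skip: "halts_within Skip s T"
  by (simp add: halts_within_def run_Skip)

lemma final_state_Skip: "final_state Skip s = return_pmf s"
  using final_state_eq[OF halts_within_Skip[of s 0]] by simp

text \<open>The coins may make \<open>c\<close> stop at different times, so the induction runs over
  the bound \<open>T\<close> and peels off one step of \<open>c\<close>. The extra step is the
  transition from \<open>Seq Skip d\<close> to \<open>d\<close>.\<close>

lemma halts_within_Seq:
  assumes "halts_within c s T" "\<And>s'. s' \<in> set_pmf (final_state c s) \<Longrightarrow> halts_within d s' T'"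
  shows "halts_within (Seq c d) s (Suc (T + T')) \<and>
    final_state (Seq c d) s = bind_pmf (final_state c s) (final_state d)"
  using assms
proof (induction T arbitrary: c s)
  case 0
  then have "c = Skip" by (simp add: halts_within_def)
  with 0 have h: "halts_within (Seq c d) s (Suc T')"
    by (simp add: halts_within_iff final_state_Skip)
  show ?case
    using h final_state_step[OF h] \<open>c = Skip\<close> by (simp add: bind_return_pmf final_state_Skip)
next
  case (Suc T)
  show ?case
  proof (cases "c = Skip")
    case True
    with Suc.prems have h': "halts_within d s T'"
      by (simp add: final_state_Skip)
    then have h: "halts_within (Seq c d) s (Suc (Suc T + T'))"
      unfolding halts_within_iff using halts_within_mono[OF h'] True by simp
    show ?thesis
      using h final_state_step[OF h] True by (simp add: bind_return_pmf final_state_Skip)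
  next
    case False
    have fs: "final_state c s = bind_pmf (step c s) (\<lambda>(c', s'). final_state c' s')"
      by (rule final_state_step) fact
    have sub: "halts_within (Seq c' d) s' (Suc (T + T'))"
      "final_state (Seq c' d) s' = bind_pmf (final_state c' s') (final_state d)"
      if "(c', s') \<in> set_pmf (step c s)" for c' s'
      using Suc.IH[of c' s'] Suc.prems that by (force simp: halts_within_iff fs)+
    have h: "halts_within (Seq c d) s (Suc (Suc T + T'))"
      unfolding halts_within_iff[of _ _ "Suc T + T'"] using sub(1) False by auto
    have "final_state (Seq c d) s = bind_pmf (step c s) (\<lambda>(c', s'). final_state (Seq c' d) s')"
      using final_state_step[OF h] False by (simp add: bind_map_pmf case_prod_unfold)
    also have "\<dots> = bind_pmf (step c s) (\<lambda>(c', s'). bind_pmf (final_state c' s') (final_state d))"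
      using sub(2) by (intro bind_pmf_cong refl) auto
    also have "\<dots> = bind_pmf (final_state c s) (final_state d)"
      unfolding fs by (simp add: bind_assoc_pmf case_prod_unfold)
    finally show ?thesis using h by simp
  qed
qed

section \<open>Quantitative triples and their rules\<close>

text \<open>
  Quantitative Hoare triples: \<open>f\<close> bounds from above the expected value of \<open>g\<close> in the final state,
  with \<open>\<infinity>\<close> standing for a violated precondition. A Boolean assertion is \<open>0\<close> where it holds and \<open>\<infinity>\<close>
  elsewhere, so ordinary triples (about all outcomes of the coins) are a special case.
\<close>

definition qtriple :: "(state \<Rightarrow> ennreal) \<Rightarrow> com \<Rightarrow> nat \<Rightarrow> (state \<Rightarrow> ennreal) \<Rightarrow> bool" where
  "qtriple f c T g \<longleftrightarrow>
     (\<forall>s. f s \<noteq> \<infinity> \<longrightarrow> halts_within c s T \<and> (\<integral>\<^sup>+s'. g s' \<partial>final_state c s) \<le> f s)"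

definition holds :: "(state \<Rightarrow> bool) \<Rightarrow> state \<Rightarrow> ennreal" where
  "holds P s = (if P s then 0 else \<infinity>)"

definition triple :: "(state \<Rightarrow> bool) \<Rightarrow> com \<Rightarrow> nat \<Rightarrow> (state \<Rightarrow> bool) \<Rightarrow> bool" where
  "triple P c T Q \<longleftrightarrow> qtriple (holds P) c T (holds Q)"

lemma qtripleI:
  "(\<And>s. f s \<noteq> \<infinity> \<Longrightarrow> halts_within c s T \<and> (\<integral>\<^sup>+s'. g s' \<partial>final_state c s) \<le> f s) \<Longrightarrow> qtriple f c T g"
  by (simp add: qtriple_def)

text \<open>A point of the support has positive mass, so an infinite value there would make the
  integral infinite. In a sequence, this makes the intermediate assertion finite wherever the second
  command can start.\<close>

lemma nn_integral_pmf_finite: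
  assumes "(\<integral>\<^sup>+x. g x \<partial>measure_pmf p) \<noteq> \<infinity>" "x \<in> set_pmf p"
  shows "g x \<noteq> \<infinity>"
proof -
  have "AE x in measure_pmf p. g x \<noteq> \<infinity>"
    using assms(1) by (intro nn_integral_PInf_AE) auto
  then show ?thesis using assms(2) by (simp add: AE_measure_pmf_iff)
qed

lemma qtriple_weaken:
  assumes "qtriple f c T g" "\<And>s. f s \<le> f' s" "\<And>s. g' s \<le> g s" "T \<le> T'"
  shows "qtriple f' c T' g'"
proof (rule qtripleI)
  fix s assume "f' s \<noteq> \<infinity>"
  then have "f s \<noteq> \<infinity>" using assms(2)[of s] by (auto simp: top_unique)
  then have h: "halts_within c s T" "(\<integral>\<^sup>+s'. g s' \<partial>final_state c s) \<le> f s"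
    using assms(1) by (auto simp: qtriple_def)
  have "(\<integral>\<^sup>+s'. g' s' \<partial>final_state c s) \<le> (\<integral>\<^sup>+s'. g s' \<partial>final_state c s)"
    by (intro nn_integral_mono assms(3))
  also note h(2)
  also note assms(2)
  finally show "halts_within c s T' \<and> (\<integral>\<^sup>+s'. g' s' \<partial>final_state c s) \<le> f' s"
    using halts_within_mono[OF h(1) assms(4)] by simp
qed

lemma qtriple_Skip: "qtriple f Skip 0 f"
  by (simp add: qtriple_def halts_within_Skip final_state_Skip nn_integral_return_pmf)

lemma qtriple_step:
  assumes "\<And>s. f s \<noteq> \<infinity> \<Longrightarrow> step c s = return_pmf (d, k s) \<and> g (k s) \<le> f s" "qtriple g d T h"
  shows "qtriple f c (Suc T) h"
proof (rule qtripleI)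
  fix s assume f: "f s \<noteq> \<infinity>"
  then have g: "step c s = return_pmf (d, k s)" "g (k s) \<le> f s"
    using assms(1) by auto
  then have d: "halts_within d (k s) T" "(\<integral>\<^sup>+s'. h s' \<partial>final_state d (k s)) \<le> g (k s)"
    using assms(2) f neq_top_trans[of "f s" "g (k s)"] by (auto simp: qtriple_def)
  then have "halts_within c s (Suc T)"
    using g by (simp add: halts_within_iff)
  moreover from final_state_step[OF this] have "final_state c s = final_state d (k s)"
    using g by (simp add: bind_return_pmf)
  ultimately show "halts_within c s (Suc T) \<and> (\<integral>\<^sup>+s'. h s' \<partial>final_state c s) \<le> f s"
    using d(2) g(2) by simp
qed

lemma qtriple_NWrite: "qtriple (\<lambda>s. g (nwrite a (nval e s) (nval f s) s)) (NWrite a e f) 1 g"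
  unfolding One_nat_def by (rule qtriple_step[OF _ qtriple_Skip]) auto

lemma qtriple_RWrite: "qtriple (\<lambda>s. g (rwrite a (nval e s) (rval f s) s)) (RWrite a e f) 1 g"
  unfolding One_nat_def by (rule qtriple_step[OF _ qtriple_Skip]) auto

text \<open>Chance enters only here: the expectation before a toss is the mean over its two
  outcomes.\<close>

lemma qtriple_Flip:
  "qtriple (\<lambda>s. (g (nwrite a (nval e s) 0 s) + g (nwrite a (nval e s) 1 s)) / 2) (Flip a e) 1 g"
proof (rule qtripleI)
  fix s
  have h: "halts_within (Flip a e) s (Suc 0)"
    by (auto simp: halts_within_iff halts_within_Skip)
  have "(\<integral>\<^sup>+s'. g s' \<partial>final_state (Flip a e) s) = (\<integral>\<^sup>+v. g (nwrite a (nval e s) v s) \<partial>pmf_of_set {0, 1})"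
    by (simp add: final_state_step[OF h] bind_map_pmf final_state_Skip nn_integral_return_pmf
      del: nn_integral_pmf_of_set)
  also have "\<dots> = (g (nwrite a (nval e s) 0 s) + g (nwrite a (nval e s) 1 s)) / 2"
    by (subst nn_integral_pmf_of_set) auto
  finally show "halts_within (Flip a e) s 1 \<and>
      (\<integral>\<^sup>+s'. g s' \<partial>final_state (Flip a e) s) \<le> (g (nwrite a (nval e s) 0 s) + g (nwrite a (nval e s) 1 s)) / 2"
    using h by simp
qed

lemma qtriple_Seq:
  assumes "qtriple f c T g" "qtriple g d T' h"
  shows "qtriple f (Seq c d) (Suc (T + T')) h"
proof (rule qtripleI)
  fix s assume "f s \<noteq> \<infinity>"
  then have c: "halts_within c s T" "(\<integral>\<^sup>+s'. g s' \<partial>final_state c s) \<le> f s"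
    using assms(1) by (auto simp: qtriple_def)
  then have "(\<integral>\<^sup>+s'. g s' \<partial>final_state c s) \<noteq> \<infinity>"
    using \<open>f s \<noteq> \<infinity>\<close> by (auto simp: top_unique)
  then have d: "halts_within d s' T'" "(\<integral>\<^sup>+s''. h s'' \<partial>final_state d s') \<le> g s'"
    if "s' \<in> set_pmf (final_state c s)" for s'
    using nn_integral_pmf_finite[OF _ that, of g] assms(2) by (auto simp: qtriple_def)
  have "halts_within (Seq c d) s (Suc (T + T'))"
    and fs: "final_state (Seq c d) s = bind_pmf (final_state c s) (final_state d)"
    using halts_within_Seq[OF c(1) d(1)] by auto
  moreover have "(\<integral>\<^sup>+s''. h s'' \<partial>final_state (Seq c d) s) \<le> (\<integral>\<^sup>+s'. g s' \<partial>final_state c s)"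
    unfolding fs nn_integral_bind_pmf using d(2)
    by (intro nn_integral_mono_AE) (auto simp: AE_measure_pmf_iff)
  ultimately show "halts_within (Seq c d) s (Suc (T + T')) \<and> (\<integral>\<^sup>+s'. h s' \<partial>final_state (Seq c d) s) \<le> f s"
    using c(2) by simp
qed

text \<open>The value \<open>\<infinity>\<close> rules out the states that take the other branch, so
  each premise speaks of its own branch only.\<close>

lemma qtriple_If:
  assumes "qtriple (\<lambda>s. if bval b s then f s else \<infinity>) c T g" "qtriple (\<lambda>s. if bval b s then \<infinity> else f s) d T g"
  shows "qtriple f (If b c d) (Suc T) g"
proof (rule qtripleI)
  fix s assume f: "f s \<noteq> \<infinity>"
  define e where "e = (if bval b s then c else d)"
  have e: "halts_within e s T" "(\<integral>\<^sup>+s'. g s' \<partial>final_state e s) \<le> f s"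
    using assms f unfolding qtriple_def e_def by (auto dest!: spec[of _ s])
  then have "halts_within (If b c d) s (Suc T)"
    unfolding halts_within_iff by (simp add: e_def)
  moreover from final_state_step[OF this] have "final_state (If b c d) s = final_state e s"
    by (simp add: bind_return_pmf e_def)
  ultimately show "halts_within (If b c d) s (Suc T) \<and> (\<integral>\<^sup>+s'. g s' \<partial>final_state (If b c d) s) \<le> f s"
    using e by simp
qed

text \<open>The number \<open>N\<close> of passes is the same for all outcomes of the coins, since a
  finite \<open>F i\<close> decides the guard. A pass costs three steps beyond the body: unfolding
  the loop, deciding the guard and leaving the finished body. The last two steps unfold the loop and
  exit.\<close>

lemma qtriple_While:
  assumes body: "\<And>i. i < N \<Longrightarrow> qtriple (F i) c T (F (Suc i))"
    and b: "\<And>i s. i \<le> N \<Longrightarrow> F i s \<noteq> \<infinity> \<Longrightarrow> bval b s \<longleftrightarrow> i < N"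
  shows "qtriple (F 0) (While b c) (N * (T + 3) + 2) (F N)"
proof -
  have "qtriple (F (N - r)) (While b c) (r * (T + 3) + 2) (F N)" if "r \<le> N" for r
    using that
  proof (induction r)
    case 0
    have "qtriple (F N) (If b (Seq c (While b c)) Skip) (Suc 0) (F N)"
      by (rule qtriple_step[OF _ qtriple_Skip, where k = "\<lambda>s. s"]) (use b in auto)
    then have "qtriple (F N) (While b c) (Suc (Suc 0)) (F N)"
      by (rule qtriple_step[rotated, where k = "\<lambda>s. s"]) auto
    then show ?case by (simp add: numeral_2_eq_2)
  next
    case (Suc r)
    let ?i = "N - Suc r"
    have i: "?i < N" "Suc ?i = N - r" using Suc.prems by auto
    have "qtriple (F ?i) (Seq c (While b c)) (Suc (T + (r * (T + 3) + 2))) (F N)"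
      using body[OF i(1)] Suc i by (intro qtriple_Seq) auto
    then have "qtriple (F ?i) (If b (Seq c (While b c)) Skip) (Suc (Suc (T + (r * (T + 3) + 2)))) (F N)"
      by (rule qtriple_step[rotated, where k = "\<lambda>s. s"]) (use i b[of ?i] in auto)
    then have "qtriple (F ?i) (While b c) (Suc (Suc (Suc (T + (r * (T + 3) + 2))))) (F N)"
      by (rule qtriple_step[rotated, where k = "\<lambda>s. s"]) auto
    then show ?case by (rule qtriple_weaken) auto
  qed
  from this[of N] show ?thesis by simp
qed

section \<open>Counting loops\<close>

abbreviation nv :: "nat \<Rightarrow> nexp" where "nv a \<equiv> NRead a (NConst 0)"
abbreviation rv :: "nat \<Rightarrow> rexp" where "rv a \<equiv> RRead a (NConst 0)"

text \<open>The bound \<open>e\<close> is evaluated again before each pass, and \<open>c\<close> may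
  read the counter.\<close>

definition For :: "nat \<Rightarrow> nexp \<Rightarrow> com \<Rightarrow> com" where
  "For v e c = Seq (NWrite v (NConst 0) (NConst 0))
     (While (NLess (nv v) e) (Seq c (NWrite v (NConst 0) (NAdd (nv v) (NConst 1)))))"

lemma narr_nwrite: "narr (nwrite a i v s) b = (if a = b then (narr s b)(i := v) else narr s b)"
  and rarr_nwrite: "rarr (nwrite a i v s) = rarr s"
  and rarr_rwrite: "rarr (rwrite a i w s) b = (if a = b then (rarr s b)(i := w) else rarr s b)"
  and narr_rwrite: "narr (rwrite a i w s) = narr s"
  by (auto simp: nwrite_def rwrite_def)

lemmas state_simps = narr_nwrite rarr_nwrite rarr_rwrite narr_rwrite

text \<open>\<open>F i\<close> must not grow when the counter is overwritten (\<open>frame\<close>).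
  The counter value is added to it in the premise on the body, so \<open>c\<close> has to return the
  counter unchanged. Advancing the counter takes two steps and the loop three, whence
  \<open>T + 5\<close>.\<close>

lemma qtriple_For:
  assumes body: "\<And>i. i < N \<Longrightarrow> qtriple (\<lambda>s. if narr s v 0 = i then F i s else \<infinity>) c T
      (\<lambda>s. if narr s v 0 = i then F (Suc i) s else \<infinity>)"
    and e: "\<And>i s. F i s \<noteq> \<infinity> \<Longrightarrow> nval e s = N"
    and frame: "\<And>i x s. F i (nwrite v 0 x s) \<le> F i s"
  shows "qtriple (F 0) (For v e c) (N * (T + 5) + 4) (F N)"
proof -
  let ?F = "\<lambda>i s. if narr s v 0 = i then F i s else \<infinity>"
  have "qtriple (?F i) (Seq c (NWrite v (NConst 0) (NAdd (nv v) (NConst 1)))) (Suc (T + 1)) (?F (Suc i))"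
    if "i < N" for i
    by (rule qtriple_Seq[OF body[OF that]], rule qtriple_weaken[OF qtriple_NWrite[where g = "?F (Suc i)"]])
      (auto simp: state_simps frame)
  then have "qtriple (?F 0) (While (NLess (nv v) e) (Seq c (NWrite v (NConst 0) (NAdd (nv v) (NConst 1)))))
      (N * (Suc (T + 1) + 3) + 2) (?F N)"
    using e by (intro qtriple_While) (auto split: if_splits)
  moreover have "qtriple (F 0) (NWrite v (NConst 0) (NConst 0)) 1 (?F 0)"
    by (rule qtriple_weaken[OF qtriple_NWrite[where g = "?F 0"]]) (auto simp: state_simps frame)
  ultimately have "qtriple (F 0) (For v e c) (Suc (1 + (N * (Suc (T + 1) + 3) + 2))) (?F N)"
    unfolding For_def by (intro qtriple_Seq)
  then show ?thesis by (rule qtriple_weaken) (auto simp: algebra_simps)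
qed

section \<open>Triples with Boolean assertions\<close>

text \<open>A function with values 0 and infinity has integral 0 exactly if it vanishes on the
  support.\<close>

lemma triple_iff:
  "triple P c T Q \<longleftrightarrow> (\<forall>s. P s \<longrightarrow> halts_within c s T \<and> (\<forall>s'\<in>set_pmf (final_state c s). Q s'))"
proof -
  have "(\<integral>\<^sup>+s'. holds Q s' \<partial>measure_pmf p) \<le> 0 \<longleftrightarrow> (\<forall>s'\<in>set_pmf p. Q s')" for p
    by (auto simp: nn_integral_0_iff_AE AE_measure_pmf_iff holds_def)
  moreover have "holds P s \<noteq> \<infinity> \<longleftrightarrow> P s" "P s \<Longrightarrow> holds P s = 0" for s
    by (simp_all add: holds_def)
  ultimately show ?thesis
    unfolding triple_def qtriple_def by auto
qed

lemma tripleD: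
  assumes "triple P c T Q" "P s"
  shows "halts_within c s T" "s' \<in> set_pmf (final_state c s) \<Longrightarrow> Q s'"
  using assms by (auto simp: triple_iff)

lemma triple_weaken:
  "triple P c T Q \<Longrightarrow> (\<And>s. P' s \<Longrightarrow> P s) \<Longrightarrow> (\<And>s. Q s \<Longrightarrow> Q' s) \<Longrightarrow> T \<le> T' \<Longrightarrow> triple P' c T' Q'"
  by (auto simp: triple_iff intro: halts_within_mono)

lemma triple_NWrite: "triple (\<lambda>s. Q (nwrite a (nval e s) (nval f s) s)) (NWrite a e f) 1 Q"
  unfolding triple_def by (rule qtriple_weaken[OF qtriple_NWrite[where g = "holds Q"]]) (auto simp: holds_def)

lemma triple_RWrite: "triple (\<lambda>s. Q (rwrite a (nval e s) (rval f s) s)) (RWrite a e f) 1 Q"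
  unfolding triple_def by (rule qtriple_weaken[OF qtriple_RWrite[where g = "holds Q"]]) (auto simp: holds_def)

lemma triple_Skip: "triple Q Skip 0 Q"
  unfolding triple_def by (rule qtriple_Skip)

lemma triple_Seq: "triple P c T Q \<Longrightarrow> triple Q d T' R \<Longrightarrow> triple P (Seq c d) (Suc (T + T')) R"
  unfolding triple_def by (rule qtriple_Seq)

lemma triple_If:
  assumes "triple (\<lambda>s. P s \<and> bval b s) c T Q" "triple (\<lambda>s. P s \<and> \<not> bval b s) d T Q"
  shows "triple P (If b c d) (Suc T) Q"
proof -
  have "holds (\<lambda>s. P s \<and> bval b s) = (\<lambda>s. if bval b s then holds P s else \<infinity>)"
    "holds (\<lambda>s. P s \<and> \<not> bval b s) = (\<lambda>s. if bval b s then \<infinity> else holds P s)"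
    by (auto simp: holds_def)
  then show ?thesis
    using assms unfolding triple_def by (intro qtriple_If) auto
qed

lemma triple_For:
  assumes body: "\<And>i. i < N \<Longrightarrow> triple (\<lambda>s. I i s \<and> narr s v 0 = i) c T (\<lambda>s. I (Suc i) s \<and> narr s v 0 = i)"
    and e: "\<And>i s. I i s \<Longrightarrow> nval e s = N"
    and frame: "\<And>i x s. I i s \<Longrightarrow> I i (nwrite v 0 x s)"
  shows "triple (I 0) (For v e c) (N * (T + 5) + 4) (I N)"
  unfolding triple_def
proof (rule qtriple_For[where F = "\<lambda>i. holds (I i)"])
  fix i assume "i < N"
  have "holds (\<lambda>s. J s \<and> narr s v 0 = i) = (\<lambda>s. if narr s v 0 = i then holds J s else \<infinity>)" for J
    by (auto simp: holds_def)
  then show "qtriple (\<lambda>s. if narr s v 0 = i then holds (I i) s else \<infinity>) c T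
      (\<lambda>s. if narr s v 0 = i then holds (I (Suc i)) s else \<infinity>)"
    using body[OF \<open>i < N\<close>] unfolding triple_def by simp
qed (use e frame in \<open>auto simp: holds_def split: if_splits\<close>)

text \<open>A bound on \<open>g\<close> at all outcomes also bounds its mean, as the final
  distribution has mass 1. This carries triples for code without coins, run from a fixed state, over
  to expectations.\<close>

lemma qtriple_if_triple:
  assumes "\<And>s0. f s0 \<noteq> \<infinity> \<Longrightarrow> triple (\<lambda>s. s = s0) c T (\<lambda>s. g s \<le> f s0)"
  shows "qtriple f c T g"
proof (rule qtripleI)
  fix s assume "f s \<noteq> \<infinity>"
  from tripleD[OF assms[OF this] refl]
  have h: "halts_within c s T" "\<And>s'. s' \<in> set_pmf (final_state c s) \<Longrightarrow> g s' \<le> f s" by auto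
  have "(\<integral>\<^sup>+s'. g s' \<partial>final_state c s) \<le> (\<integral>\<^sup>+s'. f s \<partial>final_state c s)"
    using h(2) by (intro nn_integral_mono_AE) (auto simp: AE_measure_pmf_iff)
  then show "halts_within c s T \<and> (\<integral>\<^sup>+s'. g s' \<partial>final_state c s) \<le> f s"
    using h(1) by simp
qed

section \<open>Low-degree multilinear polynomials\<close>

text \<open>
  The average over the signs of the first \<open>n\<close> coordinates, written as a recursion in the order in which
  the algorithm tosses its coins.
\<close>

primrec avg :: "nat \<Rightarrow> ((nat \<Rightarrow> real) \<Rightarrow> real) \<Rightarrow> (nat \<Rightarrow> real) \<Rightarrow> real" where
  "avg 0 f y = f y"
| "avg (Suc n) f y = (avg n f (y(n := 1)) + avg n f (y(n := -1))) / 2"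

lemma avg_add: "avg n (\<lambda>x. f x + g x) y = avg n f y + avg n g y"
  by (induction n arbitrary: y) (auto simp: field_simps)

lemma avg_cmult: "avg n (\<lambda>x. a * f x) y = a * avg n f y"
  by (induction n arbitrary: y) (auto simp: field_simps)

lemma avg_const: "avg n (\<lambda>x. a) y = a"
  by (induction n arbitrary: y) auto

lemma avg_sum: "finite I \<Longrightarrow> avg n (\<lambda>x. \<Sum>i\<in>I. f i x) y = (\<Sum>i\<in>I. avg n (f i) y)"
  by (induction I rule: finite_induct) (auto simp: avg_add avg_const)

lemma avg_mono_cube:
  assumes "\<And>x. (\<And>i. i < n \<Longrightarrow> x i \<in> {-1, 1}) \<Longrightarrow> f x \<le> g x"
  shows "avg n f y \<le> avg n g y"
proof -
  \<comment> \<open>\<open>avg\<close> fixes the highest coordinates first, so the induction assumes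
    that the coordinates from \<open>m\<close> to \<open>n - 1\<close> already carry signs; at
    \<open>m = 0\<close> all of them do.\<close>
  have "avg m f y \<le> avg m g y" if "m \<le> n" "\<And>i. i \<ge> m \<Longrightarrow> i < n \<Longrightarrow> y i \<in> {-1, 1}" for m
    using that
  proof (induction m arbitrary: y)
    case 0
    then show ?case by (auto intro: assms)
  next
    case (Suc m)
    have "avg m f (y(m := v)) \<le> avg m g (y(m := v))" if "v \<in> {-1, 1}" for v
    proof (rule Suc.IH)
      show "m \<le> n" using Suc.prems by simp
      show "(y(m := v)) i \<in> {-1, 1}" if "m \<le> i" "i < n" for i
        using Suc.prems(2)[of i] \<open>v \<in> {-1, 1}\<close> that by (cases "i = m") auto
    qed
    from this[of 1] this[of "-1"] show ?case by simp
  qed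
  then show ?thesis by simp
qed

lemma avg_mono: "(\<And>x. f x \<le> g x) \<Longrightarrow> avg n f y \<le> avg n g y"
  by (rule avg_mono_cube)

lemma avg_upd: "m \<ge> n \<Longrightarrow> avg n f (y(m := v)) = avg n (\<lambda>x. f (x(m := v))) y"
proof (induction n arbitrary: y)
  case (Suc n)
  then have "y(m := v, n := u) = y(n := u, m := v)" for u
    by (simp add: fun_upd_twist)
  with Suc show ?case by (simp del: fun_upd_apply)
qed simp

text \<open>The recursion branches on coordinate \<open>n\<close> outermost. Moving this branching
  into the integrand prepares inductions on the dimension.\<close>

lemma avg_Suc': "avg (Suc n) f y = avg n (\<lambda>x. (f (x(n := 1)) + f (x(n := -1))) / 2) y"
  using avg_cmult[of n "1/2"] by (simp add: avg_upd avg_add)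

text \<open>The average of \<open>(u * f x + v * g x)\<^sup>2\<close> is a nonnegative quadratic
  form in \<open>u\<close> and \<open>v\<close>, evaluated at suitable arguments.\<close>

lemma avg_Cauchy_Schwarz: "(avg n (\<lambda>x. f x * g x) y)\<^sup>2 \<le> avg n (\<lambda>x. (f x)\<^sup>2) y * avg n (\<lambda>x. (g x)\<^sup>2) y"
proof -
  let ?A = "avg n (\<lambda>x. (f x)\<^sup>2) y" and ?B = "avg n (\<lambda>x. (g x)\<^sup>2) y" and ?C = "avg n (\<lambda>x. f x * g x) y"
  have q: "0 \<le> u * u * ?A + 2 * u * v * ?C + v * v * ?B" for u v
  proof -
    have "0 = avg n (\<lambda>x. 0) y" by (simp add: avg_const)
    also have "\<dots> \<le> avg n (\<lambda>x. (u * f x + v * g x)\<^sup>2) y" by (rule avg_mono) simp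
    also have "(\<lambda>x. (u * f x + v * g x)\<^sup>2) = (\<lambda>x. (u * u * (f x)\<^sup>2 + 2 * u * v * (f x * g x)) + v * v * (g x)\<^sup>2)"
      by (auto simp: power2_eq_square algebra_simps)
    finally show ?thesis by (simp add: avg_add avg_cmult)
  qed
  have B: "0 \<le> ?B" using q[of 0 1] by simp
  show ?thesis
  proof (cases "?B = 0")
    case True
    have "?C = 0"
    proof (rule ccontr)
      assume "?C \<noteq> 0"
      \<comment> \<open>With \<open>?B = 0\<close> the form would be -1 at this pair.\<close>
      then show False using q[of 1 "-(?A+1) / (2 * ?C)"] True by (simp add: field_simps)
    qed
    then show ?thesis using True by simp
  next
    case False
    have "0 \<le> ?B * (?A * ?B - ?C\<^sup>2)"
      using q[of ?B "-?C"] by (simp add: power2_eq_square algebra_simps)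
    then show ?thesis using B False by (simp add: zero_le_mult_iff)
  qed
qed

section \<open>Multilinear polynomials, Parseval and Bonami\<close>

definition mlin :: "nat \<Rightarrow> (nat set \<Rightarrow> real) \<Rightarrow> (nat \<Rightarrow> real) \<Rightarrow> real" where
  "mlin n c x = (\<Sum>S\<in>Pow {..<n}. c S * (\<Prod>i\<in>S. x i))"

lemma sum_Pow_lessThan_Suc:
  fixes f :: "nat set \<Rightarrow> 'a :: comm_monoid_add"
  shows "(\<Sum>S\<in>Pow {..<Suc n}. f S) = (\<Sum>S\<in>Pow {..<n}. f S) + (\<Sum>S\<in>Pow {..<n}. f (insert n S))"
proof -
  have "inj_on (insert n) (Pow {..<n})"
    by (auto simp: inj_on_def)
  moreover have "Pow {..<n} \<inter> insert n ` Pow {..<n} = {}" by auto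
  ultimately show ?thesis
    by (simp add: lessThan_Suc Pow_insert sum.union_disjoint sum.reindex)
qed

lemma mlin_0: "mlin 0 c x = c {}"
  by (simp add: mlin_def)

text \<open>Sorting the monomials by whether they contain \<open>n\<close> gives a decomposition
  \<open>a + x n * b\<close> with \<open>a\<close> and \<open>b\<close> free of \<open>x n\<close>.
  The inductions for Parseval and Bonami rest on it.\<close>

lemma mlin_Suc: "mlin (Suc n) c x = mlin n c x + x n * mlin n (\<lambda>S. c (insert n S)) x"
proof -
  have "(\<Prod>i\<in>insert n S. x i) = x n * (\<Prod>i\<in>S. x i)" if "S \<in> Pow {..<n}" for S
    using that finite_subset[of S "{..<n}"] by (subst prod.insert) auto
  then show ?thesis
    unfolding mlin_def by (simp add: sum_Pow_lessThan_Suc sum_distrib_left mult_ac)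
qed

lemma mlin_cong:
  assumes "\<And>i. i < n \<Longrightarrow> x i = y i"
  shows "mlin n c x = mlin n c y"
proof -
  have "(\<Prod>i\<in>S. x i) = (\<Prod>i\<in>S. y i)" if "S \<in> Pow {..<n}" for S
    using that assms by (intro prod.cong) auto
  then show ?thesis
    unfolding mlin_def by simp
qed

lemma mlin_upd [simp]: "mlin n c (x(n := v)) = mlin n c x"
  by (rule mlin_cong) auto

text \<open>The cross terms of \<open>(a + b)\<^sup>2\<close> and \<open>(a - b)\<^sup>2\<close>
  cancel in the mean.\<close>

lemma Parseval: "avg n (\<lambda>x. (mlin n c x)\<^sup>2) y = (\<Sum>S\<in>Pow {..<n}. (c S)\<^sup>2)"
proof (induction n arbitrary: c y)
  case 0
  then show ?case by (simp add: mlin_0)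
next
  case (Suc n)
  have "((mlin (Suc n) c (x(n := 1)))\<^sup>2 + (mlin (Suc n) c (x(n := -1)))\<^sup>2) / 2
      = (mlin n c x)\<^sup>2 + (mlin n (\<lambda>S. c (insert n S)) x)\<^sup>2" for x
    by (simp add: mlin_Suc power2_eq_square algebra_simps)
  then have "avg (Suc n) (\<lambda>x. (mlin (Suc n) c x)\<^sup>2) y
      = avg n (\<lambda>x. (mlin n c x)\<^sup>2 + (mlin n (\<lambda>S. c (insert n S)) x)\<^sup>2) y"
    by (simp only: avg_Suc')
  then show ?case
    by (simp add: avg_add Suc.IH sum_Pow_lessThan_Suc del: avg.simps)
qed

text \<open>The arithmetic of the induction: \<open>A\<close>, \<open>B\<close> are the second and
  \<open>A4\<close>, \<open>B4\<close> the fourth moments of \<open>a\<close> and \<open>b\<close>,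
  and \<open>AB\<close> is the mean of \<open>a\<^sup>2 * b\<^sup>2\<close>. As \<open>b\<close> has
  one degree less, its bound lacks a factor 9. Cauchy-Schwarz turns this into a factor 3, so that
  the mixed term fits exactly: \<open>6 * (3 * L * A * B) = 9 * L * (2 * A * B)\<close>.\<close>

lemma Bonami_step:
  fixes A B A4 B4 AB L :: real
  assumes "AB\<^sup>2 \<le> A4 * B4" "A4 \<le> 9 * L * A\<^sup>2" "B4 \<le> L * B\<^sup>2"
    and "0 \<le> A" "0 \<le> B" "0 \<le> A4" "0 \<le> B4" "0 \<le> L"
  shows "A4 + 6 * AB + B4 \<le> 9 * L * (A + B)\<^sup>2"
proof -
  have "AB\<^sup>2 \<le> A4 * B4" by fact
  also have "\<dots> \<le> (9 * L * A\<^sup>2) * (L * B\<^sup>2)"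
    using assms(2,3,6,7,8) by (intro mult_mono) auto
  also have "\<dots> = (3 * L * A * B)\<^sup>2"
    by (simp add: power2_eq_square algebra_simps)
  finally have "AB \<le> 3 * L * A * B"
    by (rule power2_le_imp_le) (use assms(4,5,8) in simp)
  moreover have "0 \<le> L * B\<^sup>2" using assms(8) by simp
  moreover have "9 * L * (A + B)\<^sup>2 = 9 * L * A\<^sup>2 + 6 * (3 * L * A * B) + 9 * (L * B\<^sup>2)"
    by (simp add: power2_eq_square algebra_simps)
  ultimately show ?thesis
    using assms(2,3) by linarith
qed

text \<open>The (2,4) case of hypercontractivity. The induction on \<open>n\<close> keeps
  \<open>k\<close> arbitrary because the factor \<open>b\<close> of the last variable has degree at
  most \<open>k - 1\<close>; odd powers of that variable cancel in the mean.\<close>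

lemma Bonami:
  assumes "\<And>S. S \<subseteq> {..<n} \<Longrightarrow> card S > k \<Longrightarrow> c S = 0"
  shows "avg n (\<lambda>x. (mlin n c x)^4) y \<le> 9 ^ k * (avg n (\<lambda>x. (mlin n c x)\<^sup>2) y)\<^sup>2"
  using assms
proof (induction n arbitrary: c k)
  case 0
  have "1 * (c {})^4 \<le> 9 ^ k * (c {}) ^ 4"
    by (intro mult_right_mono) auto
  then show ?case by (simp add: mlin_0 flip: power_mult)
next
  case (Suc n)
  let ?a = "mlin n c" and ?b = "mlin n (\<lambda>S. c (insert n S))"
  let ?A = "avg n (\<lambda>x. (?a x)\<^sup>2) y" and ?B = "avg n (\<lambda>x. (?b x)\<^sup>2) y"
  let ?A4 = "avg n (\<lambda>x. (?a x)^4) y" and ?B4 = "avg n (\<lambda>x. (?b x)^4) y"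
  let ?AB = "avg n (\<lambda>x. (?a x)\<^sup>2 * (?b x)\<^sup>2) y"
  have sq: "avg (Suc n) (\<lambda>x. (mlin (Suc n) c x)\<^sup>2) y = ?A + ?B"
    by (simp add: Parseval sum_Pow_lessThan_Suc del: avg.simps)
  have pt: "((mlin (Suc n) c (x(n := 1)))^4 + (mlin (Suc n) c (x(n := -1)))^4) / 2
      = (?a x)^4 + 6 * ((?a x)\<^sup>2 * (?b x)\<^sup>2) + (?b x)^4" for x
  proof -
    have "((u + v)^4 + (u - v)^4) / 2 = u^4 + 6 * (u\<^sup>2 * v\<^sup>2) + v^4" for u v :: real
      by (simp add: power2_eq_square power4_eq_xxxx algebra_simps)
    then show ?thesis by (simp add: mlin_Suc)
  qed
  have q: "avg (Suc n) (\<lambda>x. (mlin (Suc n) c x)^4) y = ?A4 + 6 * ?AB + ?B4"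
    unfolding avg_Suc' pt by (simp add: avg_add avg_cmult)
  have nonneg: "0 \<le> ?A" "0 \<le> ?B" "0 \<le> ?A4" "0 \<le> ?B4" "0 \<le> ?AB"
    using avg_mono[of "\<lambda>x. 0" _ n y] by (simp_all add: avg_const)
  have A4: "?A4 \<le> 9 ^ k * ?A\<^sup>2"
    using Suc.prems by (intro Suc.IH) (auto simp: lessThan_Suc)
  have ins: "card (insert n S) = Suc (card S)" if "S \<subseteq> {..<n}" for S
    using that finite_subset[of S "{..<n}"] by (subst card_insert_disjoint) auto
  show ?case
  proof (cases k)
    case 0
    \<comment> \<open>For \<open>k = 0\<close> the degree cannot drop further, but then
      \<open>b\<close> vanishes.\<close>
    have z: "?b x = 0" for x
    proof -
      have "c (insert n S) = 0" if "S \<subseteq> {..<n}" for S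
        using Suc.prems[of "insert n S"] 0 that by (force simp: ins)
      then show ?thesis
        unfolding mlin_def by (intro sum.neutral) auto
    qed
    have "?A4 \<le> 9 ^ k * ?A\<^sup>2" by (fact A4)
    then show ?thesis unfolding q sq z by (simp add: avg_const)
  next
    case (Suc l)
    have B4: "?B4 \<le> 9 ^ l * ?B\<^sup>2"
    proof (rule Suc.IH)
      show "c (insert n S) = 0" if "S \<subseteq> {..<n}" "l < card S" for S
        using Suc.prems[of "insert n S"] Suc that by (force simp: ins)
    qed
    have "?AB\<^sup>2 \<le> ?A4 * ?B4"
      using avg_Cauchy_Schwarz[of n "\<lambda>x. (?a x)\<^sup>2" "\<lambda>x. (?b x)\<^sup>2" y]
      by (simp flip: power_mult)
    with A4 B4 nonneg show ?thesis
      unfolding q sq using Bonami_step[of "?AB" "?A4" "?B4" "9 ^ l" ?A ?B] by (simp add: Suc)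
  qed
qed

text \<open>Truncation at a level \<open>h\<close>: pointwise
  \<open>u\<^sup>2 - u ^ 4 / h\<^sup>2 \<le> h * \<bar>u\<bar>\<close>, and Bonami bounds the
  average of the subtracted term.\<close>

lemma avg_abs_mlin_ge:
  assumes "\<And>S. S \<subseteq> {..<n} \<Longrightarrow> card S > k \<Longrightarrow> c S = 0"
  shows "sqrt (\<Sum>S\<in>Pow {..<n}. (c S)\<^sup>2) / (4 * 3 ^ k) \<le> avg n (\<lambda>x. \<bar>mlin n c x\<bar>) y"
proof -
  define \<sigma> where "\<sigma> = sqrt (\<Sum>S\<in>Pow {..<n}. (c S)\<^sup>2)"
  have s2: "avg n (\<lambda>x. (mlin n c x)\<^sup>2) y = \<sigma>\<^sup>2"
    unfolding Parseval \<sigma>_def by (simp add: sum_nonneg)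
  show ?thesis
  proof (cases "\<sigma> = 0")
    case True
    then show ?thesis
      using avg_mono[of "\<lambda>x. 0" "\<lambda>x. \<bar>mlin n c x\<bar>" n y]
      by (simp add: avg_const flip: \<sigma>_def)
  next
    case False
    then have pos: "\<sigma> > 0" unfolding \<sigma>_def by (simp add: sum_nonneg less_le)
    \<comment> \<open>At this level the fourth moment contributes at most
      \<open>\<sigma>\<^sup>2 / 4\<close>. Of the remaining \<open>3 / 4\<close> only
      \<open>1 / 2\<close> is kept, for a round constant.\<close>
    define h where "h = 2 * 3 ^ k * \<sigma>"
    have h: "h > 0" using pos by (simp add: h_def)
    have pt: "u\<^sup>2 - u ^ 4 / h\<^sup>2 \<le> h * \<bar>u\<bar>" for u
    proof -
      define v where "v = \<bar>u\<bar> / h"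
      have v: "0 \<le> v" "\<bar>u\<bar> = v * h" using h by (auto simp: v_def)
      have "v\<^sup>2 - v ^ 4 \<le> v"
      proof (cases "v \<le> 1")
        case True
        then have "v\<^sup>2 \<le> v" using v by (simp add: power2_eq_square mult_left_le)
        moreover have "v ^ 4 \<ge> 0" by simp
        ultimately show ?thesis by linarith
      next
        case False
        then have "v\<^sup>2 \<le> v ^ 4" by (intro power_increasing) auto
        then show ?thesis using v(1) by linarith
      qed
      then have "h\<^sup>2 * (v\<^sup>2 - v ^ 4) \<le> h\<^sup>2 * v"
        by (intro mult_left_mono) auto
      moreover have "u\<^sup>2 = (v * h)\<^sup>2"
        by (simp flip: v(2))
      moreover have "u ^ 4 / h\<^sup>2 = h\<^sup>2 * v ^ 4"
      proof -
        have "u ^ 4 = (v * h) ^ 4" by (simp flip: v(2))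
        then show ?thesis using h by (simp add: power2_eq_square power4_eq_xxxx field_simps)
      qed
      ultimately show ?thesis
        unfolding v(2) by (simp add: power2_eq_square algebra_simps)
    qed
    have "\<sigma>\<^sup>2 - avg n (\<lambda>x. (mlin n c x) ^ 4) y / h\<^sup>2 = avg n (\<lambda>x. (mlin n c x)\<^sup>2 - (mlin n c x) ^ 4 / h\<^sup>2) y"
      using avg_add[of n "\<lambda>x. (mlin n c x)\<^sup>2" "\<lambda>x. (- 1 / h\<^sup>2) * (mlin n c x) ^ 4" y]
      by (simp only: avg_cmult) (simp add: s2)
    also have "\<dots> \<le> h * avg n (\<lambda>x. \<bar>mlin n c x\<bar>) y"
      unfolding avg_cmult[symmetric] by (rule avg_mono) (rule pt)
    finally have 1: "\<sigma>\<^sup>2 - avg n (\<lambda>x. (mlin n c x) ^ 4) y / h\<^sup>2 \<le> h * avg n (\<lambda>x. \<bar>mlin n c x\<bar>) y" .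
    have "avg n (\<lambda>x. (mlin n c x) ^ 4) y / h\<^sup>2 \<le> 9 ^ k * (\<sigma>\<^sup>2)\<^sup>2 / h\<^sup>2"
      using Bonami[of n k c y, OF assms] unfolding s2 by (intro divide_right_mono) auto
    also have "(9::real) ^ k = (3 ^ k)\<^sup>2" by (simp add: power2_eq_square flip: power_mult_distrib)
    also have "(3 ^ k)\<^sup>2 * (\<sigma>\<^sup>2)\<^sup>2 / h\<^sup>2 = \<sigma>\<^sup>2 / 4"
      using pos by (simp add: h_def power_mult_distrib field_simps power2_eq_square)
    finally have "\<sigma>\<^sup>2 * (3 / 4) \<le> h * avg n (\<lambda>x. \<bar>mlin n c x\<bar>) y"
      using 1 by linarith
    moreover have "\<sigma> * (\<sigma> / 2) \<le> \<sigma>\<^sup>2 * (3 / 4)" using zero_le_power2[of \<sigma>] by (simp add: power2_eq_square)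
    ultimately have "\<sigma> * (\<sigma> / 2) \<le> \<sigma> * (2 * 3 ^ k * avg n (\<lambda>x. \<bar>mlin n c x\<bar>) y)"
      unfolding h_def by (simp add: mult_ac)
    then have "\<sigma> / 2 \<le> 2 * 3 ^ k * avg n (\<lambda>x. \<bar>mlin n c x\<bar>) y"
      using pos by simp
    then show ?thesis
      by (simp add: field_simps flip: \<sigma>_def)
  qed
qed

section \<open>Extracting the linear coefficient of a polynomial\<close>

text \<open>
  Passing from \<open>u j\<close> to \<open>(u j - 2\<^sup>e u (j + 1)) / (1 - 2\<^sup>e\<^sup>-\<^sup>1)\<close> removes the exponent \<open>e\<close>, keeps \<open>b1\<close> and increases
  the bound by a factor of at most 5.
\<close>

lemma geometric_interpolation:
  fixes u :: "nat \<Rightarrow> real"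
  assumes "finite F" "1 \<notin> F"
    and "\<And>j. u j = b1 / 2 ^ j + (\<Sum>d\<in>F. b d / (2 ^ d) ^ j)"
    and "\<And>j. j \<le> card F \<Longrightarrow> \<bar>u j\<bar> \<le> B"
  shows "\<bar>b1\<bar> \<le> 5 ^ card F * B"
  using assms
proof (induction F arbitrary: u b B rule: finite_induct)
  case empty
  then show ?case by (metis add.right_neutral card.empty div_by_1 le0 mult_1 power_0 sum.empty)
next
  case (insert e F)
  define v where "v j = (u j - 2 ^ e * u (Suc j)) / (1 - 2 ^ e / 2)" for j
  have e: "e \<noteq> 1" using insert by auto
  have den: "(1 - 2 ^ e / 2 :: real) \<noteq> 0"
    using e power_inject_exp[of "2::real" e 1] by auto
  have "\<bar>b1\<bar> \<le> 5 ^ card F * (5 * B)"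
  proof (rule insert.IH)
    show "1 \<notin> F" using insert by auto
  next
    fix j
    have u: "u i = b1 / 2 ^ i + b e / (2 ^ e) ^ i + (\<Sum>d\<in>F. b d / (2 ^ d) ^ i)" for i
      using insert by simp
    \<comment> \<open>The term with exponent \<open>e\<close> cancels, and the linear term is
      multiplied by \<open>1 - 2 ^ e / 2\<close>, the denominator of \<open>v\<close>.\<close>
    have "2 ^ e * (b e / (2 ^ e) ^ Suc j) = b e / (2 ^ e) ^ j" "b1 / 2 ^ Suc j = b1 / 2 ^ j / 2"
      by simp_all
    then have "u j - 2 ^ e * u (Suc j) =
        b1 / 2 ^ j * (1 - 2 ^ e / 2) + ((\<Sum>d\<in>F. b d / (2 ^ d) ^ j) - 2 ^ e * (\<Sum>d\<in>F. b d / (2 ^ d) ^ Suc j))"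
      unfolding u[of j] u[of "Suc j"] by (simp only: distrib_left) (simp add: algebra_simps)
    also have "(\<Sum>d\<in>F. b d / (2 ^ d) ^ j) - 2 ^ e * (\<Sum>d\<in>F. b d / (2 ^ d) ^ Suc j)
        = (\<Sum>d\<in>F. b d * (1 - 2 ^ e / 2 ^ d) / (2 ^ d) ^ j)"
      by (simp add: sum_distrib_left sum_subtractf[symmetric] field_simps)
    finally show "v j = b1 / 2 ^ j + (\<Sum>d\<in>F. b d * (1 - 2 ^ e / 2 ^ d) / (1 - 2 ^ e / 2) / (2 ^ d) ^ j)"
      unfolding v_def using den
      by (simp add: add_divide_distrib sum_divide_distrib mult_ac)
  next
    fix j assume j: "j \<le> card F"
    \<comment> \<open>This is where 5 comes from: equality holds at \<open>e = 2\<close>, and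
      \<open>e = 1\<close> is excluded.\<close>
    have c: "1 + 2 ^ e \<le> 5 * \<bar>1 - 2 ^ e / 2 :: real\<bar>"
    proof (cases "e = 0")
      case False
      then have "(2::real) ^ 2 \<le> 2 ^ e" using e by (intro power_increasing) auto
      then show ?thesis by simp
    qed simp
    \<comment> \<open>Each elimination uses one more value of \<open>u\<close>, so
      \<open>card F + 1\<close> values suffice in total.\<close>
    have u: "\<bar>u j\<bar> \<le> B" "\<bar>u (Suc j)\<bar> \<le> B"
      using insert.prems(3) j insert.hyps by auto
    have "\<bar>u j - 2 ^ e * u (Suc j)\<bar> \<le> \<bar>u j\<bar> + \<bar>2 ^ e * u (Suc j)\<bar>" by linarith
    also have "\<dots> = \<bar>u j\<bar> + 2 ^ e * \<bar>u (Suc j)\<bar>" by (simp add: abs_mult)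
    also have "\<dots> \<le> (1 + 2 ^ e) * B"
      unfolding distrib_right mult_1 by (intro add_mono u(1) mult_left_mono[OF u(2)]) simp
    also have "\<dots> \<le> 5 * \<bar>1 - 2 ^ e / 2\<bar> * B"
      using u(1) by (intro mult_right_mono c) auto
    finally show "\<bar>v j\<bar> \<le> 5 * B"
      unfolding v_def using den by (simp add: abs_divide divide_le_eq mult_ac)
  qed
  then show ?case using insert by (simp add: mult_ac)
qed

text \<open>Along the points \<open>1 / 2 ^ Suc j\<close> the monomial of degree \<open>d\<close> is
  a geometric sequence with ratio \<open>1 / 2 ^ d\<close>, so all degrees but 1 can be eliminated.
  The linear term starts at half its coefficient, hence the factor 2.\<close>

lemma poly_coeff_1_le:
  fixes p :: "real poly"
  assumes deg: "degree p \<le> k" and "k \<ge> 1" and "\<And>j. j \<le> k \<Longrightarrow> \<bar>poly p (1 / 2 ^ Suc j)\<bar> \<le> B"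
  shows "\<bar>coeff p 1\<bar> \<le> 2 * 5 ^ k * B"
proof -
  have c: "card ({..k} - {1}) = k" using \<open>k \<ge> 1\<close> by simp
  have "\<bar>coeff p 1 / 2\<bar> \<le> 5 ^ card ({..k} - {1}) * B"
  proof (rule geometric_interpolation[where u = "\<lambda>j. poly p (1 / 2 ^ Suc j)" and b = "\<lambda>d. coeff p d / 2 ^ d"])
    fix j
    have "poly p (1 / 2 ^ Suc j) = (\<Sum>d\<le>k. coeff p d * (1 / 2 ^ Suc j) ^ d)"
      unfolding poly_altdef using deg
      by (intro sum.mono_neutral_left) (auto simp: coeff_eq_0)
    also have "\<dots> = coeff p 1 * (1 / 2 ^ Suc j) + (\<Sum>d\<in>{..k} - {1}. coeff p d * (1 / 2 ^ Suc j) ^ d)"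
      using \<open>k \<ge> 1\<close> by (subst sum.remove[of _ 1]) auto
    also have "(\<Sum>d\<in>{..k} - {1}. coeff p d * (1 / 2 ^ Suc j) ^ d) = (\<Sum>d\<in>{..k} - {1}. coeff p d / 2 ^ d / (2 ^ d) ^ j)"
      by (intro sum.cong refl) (simp add: power_divide power_mult_distrib mult.commute flip: power_mult)
    finally show "poly p (1 / 2 ^ Suc j) = coeff p 1 / 2 / 2 ^ j + (\<Sum>d\<in>{..k} - {1}. coeff p d / 2 ^ d / (2 ^ d) ^ j)"
      by simp
  qed (use assms c in auto)
  then show ?thesis using c by simp
qed

section \<open>Partial derivatives and restriction to lines\<close>

text \<open>The coefficients of the partial derivative in direction \<open>i\<close>.\<close>

definition dcoeff :: "(nat set \<Rightarrow> real) \<Rightarrow> nat \<Rightarrow> nat set \<Rightarrow> real" where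
  "dcoeff c i S = (if i \<in> S then 0 else c (insert i S))"

lemma sum_Pow_split:
  fixes f :: "nat set \<Rightarrow> 'a :: comm_monoid_add"
  assumes "i < n"
  shows "(\<Sum>S\<in>Pow {..<n}. f S) = (\<Sum>S | S \<subseteq> {..<n} \<and> i \<notin> S. f S) + (\<Sum>S | S \<subseteq> {..<n} \<and> i \<notin> S. f (insert i S))"
proof -
  have "(\<Sum>S\<in>Pow {..<n}. f S) = (\<Sum>S | S \<subseteq> {..<n} \<and> i \<notin> S. f S) + (\<Sum>S | S \<subseteq> {..<n} \<and> i \<in> S. f S)"
    by (subst sum.union_disjoint[symmetric]) (auto intro!: sum.cong)
  also have "(\<Sum>S | S \<subseteq> {..<n} \<and> i \<in> S. f S) = (\<Sum>S | S \<subseteq> {..<n} \<and> i \<notin> S. f (insert i S))"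
    using assms
    by (intro sum.reindex_bij_witness[of _ "insert i" "\<lambda>S. S - {i}"]) (auto simp: insert_absorb)
  finally show ?thesis .
qed

text \<open>\<open>dcoeff c i\<close> lives on the sets that avoid \<open>i\<close>; inserting
  \<open>i\<close> matches them with the sets that contain it. Squares for \<open>F\<close> give the
  influence, monomials the partial derivative.\<close>

lemma sum_dcoeff:
  assumes "i < n" and "\<And>S. F S 0 = 0"
  shows "(\<Sum>S\<in>Pow {..<n}. F S (dcoeff c i S)) = (\<Sum>S | S \<subseteq> {..<n} \<and> i \<in> S. F (S - {i}) (c S))"
proof -
  have "(\<Sum>S\<in>Pow {..<n}. F S (dcoeff c i S)) = (\<Sum>S | S \<subseteq> {..<n} \<and> i \<notin> S. F S (c (insert i S)))"
    unfolding sum_Pow_split[OF assms(1)] by (simp add: dcoeff_def assms(2))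
  also have "\<dots> = (\<Sum>S | S \<subseteq> {..<n} \<and> i \<in> S. F (S - {i}) (c S))"
    using assms(1)
    by (intro sum.reindex_bij_witness[of _ "\<lambda>S. S - {i}" "insert i"]) (auto simp: insert_absorb)
  finally show ?thesis .
qed

lemma mlin_affine:
  assumes "i < n"
  shows "mlin n c (x(i := v)) = mlin n c (x(i := 0)) + v * mlin n (dcoeff c i) x"
proof -
  have e: "(\<Prod>j\<in>insert i S. (x(i := v)) j) = v * (\<Prod>j\<in>S. x j)" if "S \<subseteq> {..<n}" "i \<notin> S" for S v
    using that finite_subset[of S "{..<n}"] by (subst prod.insert) (auto intro!: prod.cong)
  have ne: "(\<Prod>j\<in>S. (x(i := v)) j) = (\<Prod>j\<in>S. x j)" if "i \<notin> S" for S v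
    using that by (intro prod.cong) auto
  have "mlin n c (x(i := v)) = (\<Sum>S | S \<subseteq> {..<n} \<and> i \<notin> S. c S * (\<Prod>j\<in>S. x j))
      + v * (\<Sum>S | S \<subseteq> {..<n} \<and> i \<notin> S. c (insert i S) * (\<Prod>j\<in>S. x j))" for v
    unfolding mlin_def sum_Pow_split[OF assms]
    by (simp add: e ne sum_distrib_left mult_ac del: fun_upd_apply)
  moreover have "mlin n (dcoeff c i) x = (\<Sum>S | S \<subseteq> {..<n} \<and> i \<notin> S. c (insert i S) * (\<Prod>j\<in>S. x j))"
    unfolding mlin_def sum_Pow_split[OF assms] by (simp add: dcoeff_def)
  ultimately show ?thesis by simp
qed

text \<open>Along coordinate \<open>i\<close> the polynomial is affine, and an affine function on
  [-1, 1] has its largest absolute value at an end. This justifies rounding one coordinate at a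
  time.\<close>

lemma mlin_endpoint:
  assumes "i < n" "\<bar>x i\<bar> \<le> 1"
  shows "\<bar>mlin n c x\<bar> \<le> max \<bar>mlin n c (x(i := 1))\<bar> \<bar>mlin n c (x(i := -1))\<bar>"
proof -
  let ?a = "mlin n c (x(i := 0))" and ?b = "mlin n (dcoeff c i) x"
  have "mlin n c x = ?a + x i * ?b"
    using mlin_affine[OF assms(1), of c x "x i"] by simp
  moreover have "mlin n c (x(i := 1)) = ?a + ?b" "mlin n c (x(i := -1)) = ?a - ?b"
    using mlin_affine[OF assms(1), of c x 1] mlin_affine[OF assms(1), of c x "-1"] by simp_all
  moreover have "\<bar>x i * ?b\<bar> \<le> \<bar>?b\<bar>"
    using assms(2) by (simp add: abs_mult mult_left_le_one_le)
  ultimately show ?thesis by linarith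
qed

lemma pderiv_sum: "pderiv (\<Sum>i\<in>I. f i) = (\<Sum>i\<in>I. pderiv (f i))"
  by (induction I rule: infinite_finite_induct) (auto simp: pderiv_add)

text \<open>On the line through \<open>w\<close> in direction \<open>s\<close> the polynomial
  becomes a univariate \<open>P\<close> of degree at most \<open>k\<close>. Its linear coefficient
  is its derivative at 0, that is, the directional derivative at \<open>w\<close>.\<close>

lemma mlin_line_le:
  assumes deg: "\<And>S. S \<subseteq> {..<n} \<Longrightarrow> card S > k \<Longrightarrow> c S = 0" and "k \<ge> 1"
    and "\<And>j. j \<le> k \<Longrightarrow> \<bar>mlin n c (\<lambda>i. w i + s i / 2 ^ Suc j)\<bar> \<le> B"
  shows "\<bar>\<Sum>i<n. s i * mlin n (dcoeff c i) w\<bar> \<le> 2 * 5 ^ k * B"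
proof -
  define P where "P = (\<Sum>S\<in>Pow {..<n}. smult (c S) (\<Prod>i\<in>S. [:w i, s i:]))"
  have "degree P \<le> k"
    unfolding P_def
  proof (rule degree_sum_le)
    fix S assume S: "S \<in> Pow {..<n}"
    show "degree (smult (c S) (\<Prod>i\<in>S. [:w i, s i:])) \<le> k"
    proof (cases "card S > k")
      case True
      then show ?thesis using deg[of S] S by simp
    next
      case False
      have "degree (\<Prod>i\<in>S. [:w i, s i:]) \<le> (\<Sum>i\<in>S. degree [:w i, s i:])"
        using S finite_subset[of S "{..<n}"] degree_prod_sum_le[of S "\<lambda>i. [:w i, s i:]"] by auto
      also have "\<dots> \<le> (\<Sum>i\<in>S. 1)" by (intro sum_mono) auto
      finally show ?thesis using False by (simp add: degree_smult_le[THEN order_trans])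
    qed
  qed simp
  moreover have "poly P (1 / 2 ^ Suc j) = mlin n c (\<lambda>i. w i + s i / 2 ^ Suc j)" for j
    unfolding P_def mlin_def by (simp add: poly_sum poly_prod)
  ultimately have B: "\<bar>coeff P 1\<bar> \<le> 2 * 5 ^ k * B"
    using assms by (intro poly_coeff_1_le) auto
  have "coeff P 1 = poly (pderiv P) 0"
    by (simp add: poly_0_coeff_0 coeff_pderiv)
  also have "poly (pderiv P) 0 = (\<Sum>S\<in>Pow {..<n}. \<Sum>i\<in>S. s i * (c S * (\<Prod>j\<in>S - {i}. w j)))"
    unfolding P_def
    by (simp add: pderiv_sum pderiv_smult pderiv_prod pderiv_pCons poly_sum poly_prod sum_distrib_left mult_ac)
  also have "\<dots> = (\<Sum>S\<in>Pow {..<n}. \<Sum>i\<in>{i\<in>{..<n}. i \<in> S}. s i * (c S * (\<Prod>j\<in>S - {i}. w j)))"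
    by (intro sum.cong arg_cong2[of _ _ _ _ sum] refl) auto
  also have "\<dots> = (\<Sum>i<n. \<Sum>S\<in>{S\<in>Pow {..<n}. i \<in> S}. s i * (c S * (\<Prod>j\<in>S - {i}. w j)))"
    by (rule sum.swap_restrict) auto
  also have "\<dots> = (\<Sum>i<n. s i * mlin n (dcoeff c i) w)"
  proof (intro sum.cong refl)
    fix i assume "i \<in> {..<n}"
    then show "(\<Sum>S\<in>{S\<in>Pow {..<n}. i \<in> S}. s i * (c S * (\<Prod>j\<in>S - {i}. w j))) = s i * mlin n (dcoeff c i) w"
      unfolding mlin_def using sum_dcoeff[of i n "\<lambda>S u. u * (\<Prod>j\<in>S. w j)" c]
      by (simp add: sum_distrib_left)
  qed
  finally show ?thesis using B by simp
qed

section \<open>Anti-concentration of the gradient\<close>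

text \<open>
  A Paley-Zygmund argument for \<open>X = \<Sum>\<^sub>i \<bar>f\<^sub>i\<bar>\<close>: Bonami's lemma bounds \<open>E X\<close> from below in terms of
  \<open>\<Sum>\<^sub>i \<sigma>\<^sub>i\<close>, and \<open>E X\<^sup>2 \<le> (\<Sum>\<^sub>i \<sigma>\<^sub>i)\<^sup>2\<close> by Cauchy-Schwarz.
\<close>

lemma mlin_abs_sum_large:
  fixes e :: "'i \<Rightarrow> nat set \<Rightarrow> real" and n :: nat
  defines "\<sigma> \<equiv> \<lambda>i. sqrt (\<Sum>S\<in>Pow {..<n}. (e i S)\<^sup>2)"
  assumes deg: "\<And>i S. i \<in> I \<Longrightarrow> S \<subseteq> {..<n} \<Longrightarrow> card S > k \<Longrightarrow> e i S = 0"
    and I: "finite I" and Mpos: "(\<Sum>i\<in>I. \<sigma> i) > 0"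
  shows "1 / (64 * 9 ^ k)
    \<le> avg n (\<lambda>z. if (\<Sum>i\<in>I. \<sigma> i) / (8 * 3 ^ k) < (\<Sum>i\<in>I. \<bar>mlin n (e i) z\<bar>) then 1 else 0) y"
proof -
  define M where "M = (\<Sum>i\<in>I. \<sigma> i)"
  \<comment> \<open>Only on \<open>J\<close> is division by \<open>\<sigma> i\<close> meaningful;
    the other indices add nothing to \<open>M\<close>.\<close>
  define J where "J = {i\<in>I. \<sigma> i > 0}"
  define X where "X z = (\<Sum>i\<in>J. \<bar>mlin n (e i) z\<bar>)" for z
  define a where "a = M / (4 * 3 ^ k)"
  define p where "p = avg n (\<lambda>z. if a / 2 < X z then 1 else 0) y"
  have M: "M > 0" using Mpos by (simp add: M_def)
  have a: "a > 0" using M by (simp add: a_def)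
  have J: "finite J" "J \<subseteq> I" using I by (auto simp: J_def)
  have \<sigma>0: "\<sigma> i \<ge> 0" for i by (simp add: \<sigma>_def sum_nonneg)
  have MJ: "M = (\<Sum>i\<in>J. \<sigma> i)"
    unfolding M_def using I \<sigma>0 by (intro sum.mono_neutral_right) (auto simp: J_def less_le)
  have EX: "a \<le> avg n X y"
  proof -
    have "a = (\<Sum>i\<in>J. \<sigma> i / (4 * 3 ^ k))"
      by (simp add: a_def MJ sum_divide_distrib)
    also have "\<dots> \<le> (\<Sum>i\<in>J. avg n (\<lambda>z. \<bar>mlin n (e i) z\<bar>) y)"
      unfolding \<sigma>_def using deg J by (intro sum_mono avg_abs_mlin_ge) auto
    also have "\<dots> = avg n X y"
      unfolding X_def using J by (simp add: avg_sum)
    finally show ?thesis .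
  qed
  have EX2: "avg n (\<lambda>z. (X z)\<^sup>2) y \<le> M\<^sup>2"
  proof -
    have pt: "(X z)\<^sup>2 \<le> M * (\<Sum>i\<in>J. 1 / \<sigma> i * (mlin n (e i) z)\<^sup>2)" for z
    proof -
      \<comment> \<open>Cauchy-Schwarz with weights \<open>sqrt (\<sigma> i)\<close>: both sums on
        the right become \<open>M\<close> on average.\<close>
      have "X z = (\<Sum>i\<in>J. sqrt (\<sigma> i) * (\<bar>mlin n (e i) z\<bar> / sqrt (\<sigma> i)))"
        unfolding X_def by (intro sum.cong) (auto simp: J_def)
      then have "(X z)\<^sup>2 \<le> (\<Sum>i\<in>J. (sqrt (\<sigma> i))\<^sup>2) * (\<Sum>i\<in>J. (\<bar>mlin n (e i) z\<bar> / sqrt (\<sigma> i))\<^sup>2)"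
        by (simp only: Cauchy_Schwarz_ineq_sum)
      also have "(\<Sum>i\<in>J. (sqrt (\<sigma> i))\<^sup>2) = M"
        using \<sigma>0 by (simp add: MJ)
      also have "(\<Sum>i\<in>J. (\<bar>mlin n (e i) z\<bar> / sqrt (\<sigma> i))\<^sup>2) = (\<Sum>i\<in>J. 1 / \<sigma> i * (mlin n (e i) z)\<^sup>2)"
        using \<sigma>0 by (simp add: power_divide)
      finally show ?thesis .
    qed
    have "avg n (\<lambda>z. (X z)\<^sup>2) y \<le> avg n (\<lambda>z. M * (\<Sum>i\<in>J. 1 / \<sigma> i * (mlin n (e i) z)\<^sup>2)) y"
      by (rule avg_mono) (rule pt)
    also have "\<dots> = M * (\<Sum>i\<in>J. 1 / \<sigma> i * (\<sigma> i)\<^sup>2)"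
      using J \<sigma>0 unfolding avg_cmult
      by (subst avg_sum) (simp_all only: avg_cmult Parseval \<sigma>_def, simp_all add: sum_nonneg)
    also have "(\<Sum>i\<in>J. 1 / \<sigma> i * (\<sigma> i)\<^sup>2) = M"
      unfolding MJ by (intro sum.cong) (auto simp: J_def power2_eq_square)
    finally show ?thesis by (simp add: power2_eq_square)
  qed
  \<comment> \<open>Where \<open>X z > a / 2\<close>, the inequality
    \<open>X z \<le> (X z)\<^sup>2 / (2 * l) + l / 2\<close> is used. This \<open>l\<close> limits
    the averaged square to \<open>a / 4\<close>, so the event has to account for another
    \<open>a / 4\<close>.\<close>
  define l where "l = 2 * M\<^sup>2 / a"
  have l: "l > 0" using M a by (simp add: l_def)
  have pt: "X z \<le> a / 2 + (1 / (2 * l) * (X z)\<^sup>2 + l / 2 * (if a / 2 < X z then 1 else 0))" for z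
  proof (cases "a / 2 < X z")
    case True
    have "0 \<le> (X z - l)\<^sup>2 / (2 * l)" using l by simp
    also have "(X z - l)\<^sup>2 / (2 * l) = 1 / (2 * l) * (X z)\<^sup>2 + l / 2 - X z"
      using l by (simp add: power2_eq_square field_simps)
    finally have "X z \<le> 1 / (2 * l) * (X z)\<^sup>2 + l / 2" by simp
    then show ?thesis using True a by simp
  next
    case False
    have "0 \<le> 1 / (2 * l) * (X z)\<^sup>2" using l by simp
    then show ?thesis using False by simp
  qed
  have "a \<le> avg n X y" by (fact EX)
  also have "\<dots> \<le> avg n (\<lambda>z. a / 2 + (1 / (2 * l) * (X z)\<^sup>2 + l / 2 * (if a / 2 < X z then 1 else 0))) y"
    by (rule avg_mono) (rule pt)
  also have "\<dots> = a / 2 + (1 / (2 * l) * avg n (\<lambda>z. (X z)\<^sup>2) y + l / 2 * p)"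
    unfolding p_def by (simp only: avg_add avg_const avg_cmult)
  also have "\<dots> \<le> a / 2 + (1 / (2 * l) * M\<^sup>2 + l / 2 * p)"
    using EX2 l by (intro add_left_mono add_right_mono mult_left_mono) auto
  also have "1 / (2 * l) * M\<^sup>2 = a / 4"
    using M a by (simp add: l_def field_simps)
  finally have "a / 4 \<le> l / 2 * p" by simp
  also have "l / 2 * p = M\<^sup>2 / a * p" by (simp add: l_def)
  finally have "(a / M)\<^sup>2 / 4 \<le> p"
    using M a by (simp add: field_simps power2_eq_square)
  moreover have "(a / M)\<^sup>2 / 4 = 1 / (64 * (3 ^ k)\<^sup>2)"
    using M by (simp add: a_def power_divide power_mult_distrib)
  moreover have "(3 ^ k)\<^sup>2 = (9 :: real) ^ k"
    by (simp add: power2_eq_square flip: power_mult_distrib)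
  ultimately have "1 / (64 * 9 ^ k) \<le> p" by simp
  also have "p \<le> avg n (\<lambda>z. if (\<Sum>i\<in>I. \<sigma> i) / (8 * 3 ^ k) < (\<Sum>i\<in>I. \<bar>mlin n (e i) z\<bar>) then 1 else 0) y"
    unfolding p_def
  proof (rule avg_mono)
    fix z
    have "a / 2 = (\<Sum>i\<in>I. \<sigma> i) / (8 * 3 ^ k)" by (simp add: a_def M_def)
    moreover have "X z \<le> (\<Sum>i\<in>I. \<bar>mlin n (e i) z\<bar>)"
      unfolding X_def using I J by (intro sum_mono2) auto
    ultimately show "(if a / 2 < X z then 1 else 0)
        \<le> (if (\<Sum>i\<in>I. \<sigma> i) / (8 * 3 ^ k) < (\<Sum>i\<in>I. \<bar>mlin n (e i) z\<bar>) then 1 else 0 :: real)"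
      by simp
  qed
  finally show ?thesis .
qed

text \<open>The two values differ by twice the partial derivative, so comparing two evaluations
  reveals its sign. A vanishing derivative gets sign 1.\<close>

definition grad_sign :: "nat \<Rightarrow> (nat set \<Rightarrow> real) \<Rightarrow> (nat \<Rightarrow> real) \<Rightarrow> nat \<Rightarrow> real" where
  "grad_sign n c w i = (if mlin n c (w(i := 1)) < mlin n c (w(i := -1)) then -1 else 1)"

text \<open>The index \<open>j\<close> runs up to \<open>n\<close> because the program knows
  \<open>n\<close> but not the degree.\<close>

definition good_start :: "nat \<Rightarrow> (nat set \<Rightarrow> real) \<Rightarrow> real \<Rightarrow> (nat \<Rightarrow> real) \<Rightarrow> bool" where
  "good_start n c t w \<longleftrightarrow> (\<exists>j\<le>n. t \<le> \<bar>mlin n c (\<lambda>i. w i + grad_sign n c w i / 2 ^ Suc j)\<bar>)"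

lemma grad_sign:
  assumes "i < n"
  shows "grad_sign n c w i * mlin n (dcoeff c i) w = \<bar>mlin n (dcoeff c i) w\<bar>"
  using mlin_affine[OF assms, of c w 1] mlin_affine[OF assms, of c w "-1"]
  by (simp add: grad_sign_def)

text \<open>Halving the point only rescales coefficients, so the derivatives at a random half-sign
  point are low-degree polynomials of signs.\<close>

lemma mlin_half: "mlin n c (\<lambda>i. z i / 2) = mlin n (\<lambda>S. c S / 2 ^ card S) z"
  unfolding mlin_def by (simp add: prod_dividef)

text \<open>In the sign direction the linear coefficient is the l1 norm of the gradient. If all
  steps stayed below \<open>t\<close>, it would be at most \<open>2 * 5 ^ k * t\<close>.\<close>

lemma good_start_if_large_gradient:
  assumes deg: "\<And>S. S \<subseteq> {..<n} \<Longrightarrow> card S > k \<Longrightarrow> c S = 0" and k: "k \<ge> 1" "k \<le> n"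
    and large: "2 * 5 ^ k * t < (\<Sum>i<n. \<bar>mlin n (dcoeff c i) w\<bar>)"
  shows "good_start n c t w"
proof (rule ccontr)
  assume "\<not> good_start n c t w"
  then have "\<bar>mlin n c (\<lambda>i. w i + grad_sign n c w i / 2 ^ Suc j)\<bar> \<le> t" if "j \<le> k" for j
    using that k(2) unfolding good_start_def by (meson le_trans nle_le)
  from mlin_line_le[OF deg k(1) this]
  have "\<bar>\<Sum>i<n. grad_sign n c w i * mlin n (dcoeff c i) w\<bar> \<le> 2 * 5 ^ k * t" by simp
  also have "(\<Sum>i<n. grad_sign n c w i * mlin n (dcoeff c i) w) = (\<Sum>i<n. \<bar>mlin n (dcoeff c i) w\<bar>)"
    by (intro sum.cong) (auto simp: grad_sign)
  finally show False using large by simp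
qed

text \<open>The influence bound acts twice. It makes the sum of the square roots of the influences
  large, and together with \<open>total\<close> it forces \<open>n\<close> to be so large that
  \<open>1 / sqrt n\<close> lies below the Paley-Zygmund probability.\<close>

lemma good_start_probability:
  fixes c :: "nat set \<Rightarrow> real" and t :: real and n :: nat
  defines "inf_of \<equiv> \<lambda>i. \<Sum>S | S \<subseteq> {..<n} \<and> i \<in> S. (c S)\<^sup>2"
  assumes deg: "\<And>S. S \<subseteq> {..<n} \<Longrightarrow> card S > k \<Longrightarrow> c S = 0" and kn: "k \<le> n"
    and total: "1 \<le> (\<Sum>i<n. inf_of i)" and t: "t \<ge> 1"
    and small: "\<And>i. i < n \<Longrightarrow> inf_of i \<le> 1 / (1000000 ^ k * t\<^sup>2)"
  shows "1 / sqrt n \<le> avg n (\<lambda>z. if good_start n c t (\<lambda>i. z i / 2) then 1 else 0) y"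
proof -
  \<comment> \<open>A constant has no influences, so \<open>k = 0\<close> contradicts
    \<open>total\<close>.\<close>
  have "inf_of i = 0" if "k = 0" "i < n" for i
  proof -
    have "c S = 0" if "S \<subseteq> {..<n}" "i \<in> S" for S
      using that finite_subset[of S "{..<n}"] \<open>k = 0\<close> by (intro deg) (auto simp: card_gt_0_iff)
    then show ?thesis unfolding inf_of_def by (intro sum.neutral) auto
  qed
  then have k: "k \<ge> 1" using total by (cases "k = 0") auto
  \<comment> \<open>\<open>D\<close> is the square root of \<open>1000000 ^ k\<close>. It dominates
    \<open>64 * 9 ^ k\<close>, the inverse success probability, and \<open>16 * 30 ^ k\<close>, the
    product of the losses \<open>2 * 5 ^ k\<close> (interpolation), \<open>8 * 3 ^ k\<close>
    (anti-concentration) and \<open>2 ^ k\<close> (halving the point).\<close>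
  define D :: real where "D = 1000 ^ k"
  have D2: "(1000000::real) ^ k = D\<^sup>2" by (simp add: D_def power2_eq_square flip: power_mult_distrib)
  have D: "D > 0" "64 * 9 ^ k \<le> D" "16 * 30 ^ k \<le> D"
  proof -
    have "(64::real) ^ 1 \<le> 64 ^ k" using k by (intro power_increasing) auto
    then have "(64::real) * 9 ^ k \<le> 64 ^ k * 9 ^ k" by simp
    also have "\<dots> \<le> D" unfolding D_def power_mult_distrib[symmetric] by (intro power_mono) auto
    finally show "64 * 9 ^ k \<le> D" .
    have "(16::real) ^ 1 \<le> 16 ^ k" using k by (intro power_increasing) auto
    then have "(16::real) * 30 ^ k \<le> 16 ^ k * 30 ^ k" by simp
    also have "\<dots> \<le> D" unfolding D_def power_mult_distrib[symmetric] by (intro power_mono) auto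
    finally show "16 * 30 ^ k \<le> D" .
  qed (simp add: D_def)
  have Inf0: "inf_of i \<ge> 0" for i by (simp add: inf_of_def sum_nonneg)
  have small': "inf_of i \<le> 1 / (D * t)\<^sup>2" if "i < n" for i
    using small[OF that] by (simp add: D2 power_mult_distrib)
  have n: "D\<^sup>2 \<le> n"
  proof -
    have "1 \<le> (\<Sum>i<n. 1 / (D * t)\<^sup>2)"
      using total sum_mono[of "{..<n}" inf_of "\<lambda>_. 1 / (D * t)\<^sup>2"] small' by auto
    then have "(D * t)\<^sup>2 \<le> n" using D t by (simp add: field_simps)
    moreover have "D\<^sup>2 \<le> (D * t)\<^sup>2" using D t by (intro power_mono) auto
    ultimately show ?thesis by linarith
  qed
  then have "D \<le> sqrt n" by (simp add: real_le_rsqrt)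
  \<comment> \<open>The coefficients of the \<open>i\<close>-th derivative at \<open>z / 2\<close>
    as a polynomial of \<open>z\<close>.\<close>
  define e where "e i S = dcoeff c i S / 2 ^ card S" for i S
  define \<sigma> where "\<sigma> i = sqrt (\<Sum>S\<in>Pow {..<n}. (e i S)\<^sup>2)" for i
  have sig: "D * t / 2 ^ k * inf_of i \<le> \<sigma> i" if i: "i < n" for i
  proof -
    have "inf_of i / 4 ^ k \<le> (\<Sum>S\<in>Pow {..<n}. (e i S)\<^sup>2)"
    proof -
      have "inf_of i / 4 ^ k = (\<Sum>S\<in>Pow {..<n}. (dcoeff c i S)\<^sup>2 / 4 ^ k)"
        unfolding inf_of_def using sum_dcoeff[OF i, of "\<lambda>S u. u\<^sup>2" c] by (simp flip: sum_divide_distrib)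
      also have "\<dots> \<le> (\<Sum>S\<in>Pow {..<n}. (e i S)\<^sup>2)"
      proof (rule sum_mono)
        fix S assume S: "S \<in> Pow {..<n}"
        show "(dcoeff c i S)\<^sup>2 / 4 ^ k \<le> (e i S)\<^sup>2"
        proof (cases "dcoeff c i S = 0")
          case False
          then have "i \<notin> S" "c (insert i S) \<noteq> 0" by (auto simp: dcoeff_def split: if_splits)
          then have "card S \<le> k"
            using deg[of "insert i S"] S i finite_subset[of S "{..<n}"] by force
          have "(dcoeff c i S)\<^sup>2 / 4 ^ k \<le> (dcoeff c i S)\<^sup>2 / 4 ^ card S"
            using \<open>card S \<le> k\<close> by (intro divide_left_mono power_increasing) auto
          also have "(4::real) ^ card S = (2 ^ card S)\<^sup>2"
            by (simp add: power2_eq_square flip: power_mult_distrib)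
          finally show ?thesis by (simp add: e_def power_divide)
        qed simp
      qed
      finally show ?thesis .
    qed
    then have "sqrt (inf_of i / 4 ^ k) \<le> \<sigma> i" unfolding \<sigma>_def by simp
    moreover have "sqrt (4 ^ k) = (2::real) ^ k"
      by (simp add: real_sqrt_power)
    ultimately have "sqrt (inf_of i) / 2 ^ k \<le> \<sigma> i" by (simp add: real_sqrt_divide)
    \<comment> \<open>A small influence lies far below its square root. This replaces the square
      roots by the influences, whose sum \<open>total\<close> controls.\<close>
    moreover have "D * t * inf_of i \<le> sqrt (inf_of i)"
    proof -
      have "sqrt (inf_of i) \<le> 1 / (D * t)"
        using small'[OF i] D t by (intro real_le_lsqrt) (auto simp: power_divide)
      then have "D * t * sqrt (inf_of i) \<le> 1" using D t by (simp add: field_simps)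
      then have "D * t * sqrt (inf_of i) * sqrt (inf_of i) \<le> 1 * sqrt (inf_of i)"
        using Inf0 by (intro mult_right_mono) auto
      then show ?thesis using Inf0 by (simp add: mult.assoc)
    qed
    then have "D * t * inf_of i / 2 ^ k \<le> sqrt (inf_of i) / 2 ^ k" by (intro divide_right_mono) auto
    ultimately show ?thesis by simp
  qed
  have M: "D * t / 2 ^ k \<le> (\<Sum>i<n. \<sigma> i)"
  proof -
    have "D * t / 2 ^ k * 1 \<le> D * t / 2 ^ k * (\<Sum>i<n. inf_of i)"
      using total D t by (intro mult_left_mono) auto
    also have "\<dots> = (\<Sum>i<n. D * t / 2 ^ k * inf_of i)" by (simp add: sum_distrib_left)
    also have "\<dots> \<le> (\<Sum>i<n. \<sigma> i)" by (intro sum_mono sig) auto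
    finally show ?thesis by simp
  qed
  have Mpos: "0 < (\<Sum>i<n. \<sigma> i)"
    using M D t by (auto intro: less_le_trans[rotated])
  have edeg: "e i S = 0" if "i \<in> {..<n}" "S \<subseteq> {..<n}" "card S > k" for i S
  proof -
    have "c (insert i S) = 0" if "i \<notin> S"
      using that \<open>i \<in> {..<n}\<close> \<open>S \<subseteq> {..<n}\<close> \<open>card S > k\<close> finite_subset[of S "{..<n}"] by (intro deg) auto
    then show ?thesis by (simp add: e_def dcoeff_def)
  qed
  have "1 / sqrt n \<le> 1 / (64 * 9 ^ k)"
  proof (rule divide_left_mono)
    show "64 * 9 ^ k \<le> sqrt n" using D \<open>D \<le> sqrt n\<close> by linarith
    have "0 < sqrt n" using D(1) \<open>D \<le> sqrt n\<close> by linarith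
    then show "0 < sqrt n * (64 * 9 ^ k)" by simp
  qed simp
  also have "\<dots> \<le> avg n (\<lambda>z. if (\<Sum>i<n. \<sigma> i) / (8 * 3 ^ k) < (\<Sum>i<n. \<bar>mlin n (e i) z\<bar>) then 1 else 0) y"
    using mlin_abs_sum_large[of "{..<n}" n k e y] edeg Mpos unfolding \<sigma>_def by simp
  also have "\<dots> \<le> avg n (\<lambda>z. if good_start n c t (\<lambda>i. z i / 2) then 1 else 0) y"
  proof (rule avg_mono)
    fix z
    have "good_start n c t (\<lambda>i. z i / 2)" if "(\<Sum>i<n. \<sigma> i) / (8 * 3 ^ k) < (\<Sum>i<n. \<bar>mlin n (e i) z\<bar>)"
    proof (rule good_start_if_large_gradient[OF deg k kn])
      have "2 * 5 ^ k * t = 16 * 30 ^ k * t / 2 ^ k / (8 * 3 ^ k)"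
        by (simp add: field_simps flip: power_mult_distrib)
      also have "\<dots> \<le> D * t / 2 ^ k / (8 * 3 ^ k)"
        using D t by (intro divide_right_mono mult_right_mono) auto
      also have "\<dots> \<le> (\<Sum>i<n. \<sigma> i) / (8 * 3 ^ k)"
        using M by (intro divide_right_mono) auto
      also note that
      also have "(\<Sum>i<n. \<bar>mlin n (e i) z\<bar>) = (\<Sum>i<n. \<bar>mlin n (dcoeff c i) (\<lambda>i. z i / 2)\<bar>)"
        by (simp add: mlin_half e_def[abs_def])
      finally show "2 * 5 ^ k * t < (\<Sum>i<n. \<bar>mlin n (dcoeff c i) (\<lambda>i. z i / 2)\<bar>)" .
    qed
    then show "(if (\<Sum>i<n. \<sigma> i) / (8 * 3 ^ k) < (\<Sum>i<n. \<bar>mlin n (e i) z\<bar>) then 1 else 0)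
        \<le> (if good_start n c t (\<lambda>i. z i / 2) then 1 else 0 :: real)"
      by simp
  qed
  finally show ?thesis .
qed

section \<open>Variance and total influence\<close>

text \<open>Expanding one factor of the square of \<open>g\<close> leaves correlations of
  \<open>g\<close> with characters, which are its coefficients. Subtracting the squared mean removes
  the empty set.\<close>

lemma cube_variance_eq:
  "cube_variance n g = (\<Sum>S\<in>Pow {..<n} - {{}}. (fourier_coeff n g S)\<^sup>2)"
proof -
  let ?c = "fourier_coeff n g"
  have g: "g x = mlin n ?c x" if "x \<in> cube n" for x
    using fourier_coeff_expansion[of n g] that
    by (simp add: is_multilinear_expansion_def mlin_def)
  have E: "measure_pmf.expectation (pmf_of_set (cube n)) f = (\<Sum>x\<in>cube n. f x) / 2 ^ n" for f :: "_ \<Rightarrow> real"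
    by (subst integral_pmf_of_set) (simp_all add: cube_nonempty finite_cube card_cube)
  have "(\<Sum>x\<in>cube n. g x) / 2 ^ n = ?c {}"
    using multilinear_expansion_coeff[OF fourier_coeff_expansion, of "{}" n g] by simp
  moreover have "(\<Sum>x\<in>cube n. (g x)\<^sup>2) / 2 ^ n = (\<Sum>S\<in>Pow {..<n}. (?c S)\<^sup>2)"
  proof -
    have "(\<Sum>x\<in>cube n. (g x)\<^sup>2) = (\<Sum>x\<in>cube n. \<Sum>S\<in>Pow {..<n}. ?c S * (g x * (\<Prod>i\<in>S. x i)))"
      by (intro sum.cong refl) (simp add: power2_eq_square, subst (1) g, simp_all add: mlin_def sum_distrib_left mult_ac)
    also have "\<dots> = (\<Sum>S\<in>Pow {..<n}. ?c S * (\<Sum>x\<in>cube n. g x * (\<Prod>i\<in>S. x i)))"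
      by (subst sum.swap) (simp add: sum_distrib_left)
    also have "\<dots> = (\<Sum>S\<in>Pow {..<n}. 2 ^ n * (?c S)\<^sup>2)"
      using multilinear_expansion_coeff[OF fourier_coeff_expansion, of _ n g]
      by (intro sum.cong) (auto simp: power2_eq_square)
    finally show ?thesis by (simp flip: sum_distrib_left)
  qed
  moreover have "measure_pmf.variance (pmf_of_set (cube n)) g
      = measure_pmf.expectation (pmf_of_set (cube n)) (\<lambda>x. (g x)\<^sup>2) - (measure_pmf.expectation (pmf_of_set (cube n)) g)\<^sup>2"
    by (rule measure_pmf.variance_eq) (auto intro!: integrable_measure_pmf_finite simp: cube_nonempty finite_cube)
  ultimately show ?thesis
    unfolding cube_variance_def E by (simp add: sum_diff1)
qed

text \<open>In the total influence a set is counted once for each of its elements, so every nonempty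
  set is counted at least once.\<close>

lemma cube_variance_le_influences: "cube_variance n g \<le> (\<Sum>i<n. influence n g i)"
proof -
  let ?f = "\<lambda>S. (fourier_coeff n g S)\<^sup>2"
  have "(\<Sum>i<n. influence n g i) = (\<Sum>i<n. \<Sum>S\<in>{S\<in>Pow {..<n}. i \<in> S}. ?f S)"
    by (simp add: influence_def)
  also have "\<dots> = (\<Sum>S\<in>Pow {..<n}. \<Sum>i\<in>{i\<in>{..<n}. i \<in> S}. ?f S)"
    by (rule sum.swap_restrict) auto
  also have "\<dots> \<ge> (\<Sum>S\<in>Pow {..<n} - {{}}. \<Sum>i\<in>{i\<in>{..<n}. i \<in> S}. ?f S)"
    by (intro sum_mono2) (auto intro: sum_nonneg)
  also have "(\<Sum>S\<in>Pow {..<n} - {{}}. \<Sum>i\<in>{i\<in>{..<n}. i \<in> S}. ?f S) \<ge> (\<Sum>S\<in>Pow {..<n} - {{}}. ?f S)"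
  proof (rule sum_mono)
    fix S assume "S \<in> Pow {..<n} - {{}}"
    then obtain i where "i \<in> {i\<in>{..<n}. i \<in> S}" by auto
    then show "?f S \<le> (\<Sum>i\<in>{i\<in>{..<n}. i \<in> S}. ?f S)"
      by (intro member_le_sum[of i _ "\<lambda>_. ?f S"]) auto
  qed
  finally show ?thesis unfolding cube_variance_eq by simp
qed

section \<open>The algorithm and its verification\<close>

notation Seq (infixr ";;" 60)

section \<open>The program\<close>

text \<open>
  Cells 0 of the arrays below serve as scalar variables. Naturals: 2 is the last coin, 3, 4, 6, 8 and
  9 are loop counters, 5 is the reading position in array 1, 7 the size of the current monomial.
  Reals: array 2 is the random starting point, 3 the point at which the polynomial is evaluated, 4 the
  signs of the gradient; scalar 5 is the value of the polynomial, 6 the current monomial, 7 a second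
  value, 8 the best squared value so far (\<open>-1\<close> if there is none), 9 the step size.
\<close>

definition eval_com :: com where
  "eval_com =
     NWrite 5 (NConst 0) (NConst 0) ;;
     RWrite 5 (NConst 0) (RConst 0) ;;
     For 4 (NRead 0 (NConst 1))
       (RWrite 6 (NConst 0) (RRead 0 (nv 4)) ;;
        NWrite 7 (NConst 0) (NRead 1 (nv 5)) ;;
        NWrite 5 (NConst 0) (NAdd (nv 5) (NConst 1)) ;;
        For 6 (nv 7)
          (RWrite 6 (NConst 0) (RMul (rv 6) (RRead 3 (NRead 1 (nv 5)))) ;;
           NWrite 5 (NConst 0) (NAdd (nv 5) (NConst 1))) ;;
        RWrite 5 (NConst 0) (RAdd (rv 5) (rv 6)))"

text \<open>On exit scalar 7 holds the value for coordinate 1, scalar 5 the value for coordinate -1,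
  and the coordinate is left at -1.\<close>

definition compare_com :: com where
  "compare_com =
     RWrite 3 (nv 3) (RConst 1) ;; eval_com ;; RWrite 7 (NConst 0) (rv 5) ;;
     RWrite 3 (nv 3) (RConst (-1)) ;; eval_com"

definition signs_com :: com where
  "signs_com =
     For 3 (nv 0) (RWrite 3 (nv 3) (RRead 2 (nv 3))) ;;
     For 3 (nv 0)
       (compare_com ;;
        If (RLess (rv 7) (rv 5)) (RWrite 4 (nv 3) (RConst (-1))) (RWrite 4 (nv 3) (RConst 1)) ;;
        RWrite 3 (nv 3) (RRead 2 (nv 3)))"

text \<open>Squares are compared in place of absolute values. The second branch is
  \<open>Skip\<close> because the coordinate already is -1.\<close>

definition round_com :: com where
  "round_com =
     For 3 (nv 0)
       (compare_com ;;
        If (RLess (RMul (rv 5) (rv 5)) (RMul (rv 7) (rv 7))) (RWrite 3 (nv 3) (RConst 1)) Skip)"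

definition record_com :: com where
  "record_com =
     eval_com ;;
     If (RLess (rv 8) (RMul (rv 5) (rv 5)))
       (For 3 (nv 0) (RWrite 1 (nv 3) (RRead 3 (nv 3))) ;;
        RWrite 8 (NConst 0) (RMul (rv 5) (rv 5)))
       Skip"

definition search_com :: com where
  "search_com =
     RWrite 9 (NConst 0) (RDiv (RConst 1) (RConst 2)) ;;
     For 9 (NAdd (nv 0) (NConst 1))
       (For 3 (nv 0) (RWrite 3 (nv 3) (RAdd (RRead 2 (nv 3)) (RMul (rv 9) (RRead 4 (nv 3))))) ;;
        round_com ;; record_com ;;
        RWrite 9 (NConst 0) (RDiv (rv 9) (RConst 2)))"

text \<open>The counter runs downwards, so that the coins fix the coordinates in the order of the
  recursion of \<open>avg\<close>.\<close>

definition start_com :: com where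
  "start_com =
     NWrite 3 (NConst 0) (nv 0) ;;
     While (NLess (NConst 0) (nv 3))
       (NWrite 3 (NConst 0) (NSub (nv 3) (NConst 1)) ;;
        Flip 2 (NConst 0) ;;
        If (NLess (NConst 0) (nv 2))
          (RWrite 2 (nv 3) (RDiv (RConst 1) (RConst 2)))
          (RWrite 2 (nv 3) (RDiv (RConst (-1)) (RConst 2))))"

definition main_com :: com where
  "main_com =
     RWrite 8 (NConst 0) (RConst (-1)) ;;
     For 8 (nv 0) (start_com ;; signs_com ;; search_com)"

section \<open>Rules for backward reasoning\<close>

lemma triple_conseq:
  "triple P' c T' Q \<Longrightarrow> (\<And>s. P s \<Longrightarrow> P' s) \<Longrightarrow> T' \<le> T \<Longrightarrow> triple P c T Q"
  by (rule triple_weaken)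

text \<open>With the premise on the second command first, the intermediate assertion is already
  determined when the first command is treated.\<close>

lemma triple_Seq_backward: "triple Q d T' R \<Longrightarrow> triple P c T Q \<Longrightarrow> triple P (c ;; d) (Suc (T + T')) R"
  by (rule triple_Seq)

lemma triple_If_backward:
  assumes "triple P1 c T1 Q" "triple P2 d T2 Q"
  shows "triple (\<lambda>s. if bval b s then P1 s else P2 s) (If b c d) (Suc (max T1 T2)) Q"
  using assms by (intro triple_If; elim triple_weaken) auto

section \<open>Verification of the deterministic commands\<close>

locale stored_polynomial =
  fixes n :: nat and Ss :: "nat set list" and c :: "nat set \<Rightarrow> real"
  assumes dist: "distinct Ss" and sub: "\<And>S. S \<in> set Ss \<Longrightarrow> S \<subseteq> {..<n}"
    and nz: "\<And>S. S \<notin> set Ss \<Longrightarrow> c S = 0"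
begin

abbreviation "m \<equiv> length Ss"

abbreviation "G \<equiv> mlin n c"

definition code :: "nat set list \<Rightarrow> nat list" where
  "code Us = concat (map (\<lambda>S. card S # sorted_list_of_set S) Us)"

text \<open>Only the input arrays are constrained; none of the commands writes to them, so this is
  an invariant of the whole program.\<close>

definition stored :: "state \<Rightarrow> bool" where
  "stored s \<longleftrightarrow> narr s 0 = nth_default 0 [n, m] \<and> narr s 1 = nth_default 0 (code Ss) \<and>
     rarr s 0 = nth_default 0 (map c Ss)"

lemma stored_n: "stored s \<Longrightarrow> narr s 0 0 = n"
  and stored_m: "stored s \<Longrightarrow> narr s 0 (Suc 0) = m"
  and stored_coeff: "stored s \<Longrightarrow> j < m \<Longrightarrow> rarr s 0 j = c (Ss ! j)"
  by (auto simp: stored_def nth_default_def)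

lemma finite_sub: "S \<in> set Ss \<Longrightarrow> finite S"
  using sub finite_subset by blast

lemma G_eq_sum: "G x = (\<Sum>j<m. c (Ss ! j) * (\<Prod>i\<in>Ss ! j. x i))"
proof -
  have "G x = (\<Sum>S\<in>set Ss. c S * (\<Prod>i\<in>S. x i))"
    unfolding mlin_def using sub nz by (intro sum.mono_neutral_right) auto
  also have "\<dots> = (\<Sum>j<m. c (Ss ! j) * (\<Prod>i\<in>Ss ! j. x i))"
    using bij_betw_nth[OF dist refl refl] by (subst sum.reindex_bij_betw) auto
  finally show ?thesis .
qed

definition offset :: "nat \<Rightarrow> nat" where
  "offset j = length (code (take j Ss))"

lemma code_split:
  assumes "j < m"
  shows "code Ss = code (take j Ss) @ (card (Ss ! j) # sorted_list_of_set (Ss ! j)) @ code (drop (Suc j) Ss)"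
  by (subst id_take_nth_drop[OF assms]) (simp add: code_def)

lemma offset_0: "offset 0 = 0"
  by (simp add: offset_def code_def)

lemma offset_Suc: "j < m \<Longrightarrow> offset (Suc j) = offset j + 1 + card (Ss ! j)"
  by (simp add: offset_def code_def take_Suc_conv_app_nth)

lemma stored_size:
  assumes "stored s" "j < m"
  shows "narr s 1 (offset j) = card (Ss ! j)"
proof -
  have "code Ss ! offset j = card (Ss ! j)" "offset j < length (code Ss)"
    by (simp_all add: code_split[OF assms(2)] offset_def nth_append)
  then show ?thesis using assms by (simp add: stored_def nth_default_def)
qed

lemma stored_var:
  assumes "stored s" "j < m" "q < card (Ss ! j)"
  shows "narr s 1 (Suc (offset j + q)) = sorted_list_of_set (Ss ! j) ! q"
proof -
  have "code Ss ! Suc (offset j + q) = sorted_list_of_set (Ss ! j) ! q" "Suc (offset j + q) < length (code Ss)"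
    using assms(3) by (simp_all add: code_split[OF assms(2)] offset_def nth_append)
  then show ?thesis using assms by (simp add: stored_def nth_default_def)
qed

definition same_outside_eval :: "state \<Rightarrow> state \<Rightarrow> bool" where
  "same_outside_eval s s' \<longleftrightarrow>
     narr s' 0 = narr s 0 \<and> narr s' 1 = narr s 1 \<and> narr s' 2 = narr s 2 \<and> narr s' 3 = narr s 3 \<and>
     narr s' 8 = narr s 8 \<and> narr s' 9 = narr s 9 \<and>
     rarr s' 0 = rarr s 0 \<and> rarr s' 1 = rarr s 1 \<and> rarr s' 2 = rarr s 2 \<and> rarr s' 3 = rarr s 3 \<and>
     rarr s' 4 = rarr s 4 \<and> rarr s' 7 = rarr s 7 \<and> rarr s' 8 = rarr s 8 \<and> rarr s' 9 = rarr s 9"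

lemma same_outside_eval_write:
  "a \<in> {4, 5, 6, 7} \<Longrightarrow> same_outside_eval s (nwrite a i v s') = same_outside_eval s s'"
  "a \<in> {5, 6} \<Longrightarrow> same_outside_eval s (rwrite a i w s') = same_outside_eval s s'"
  by (auto simp: same_outside_eval_def state_simps)

definition eval_time :: nat where
  "eval_time = m * (n * 8 + 17) + 8"

lemma triple_eval_from:
  assumes "stored s0"
  shows "triple (\<lambda>s. s = s0) eval_com eval_time
    (\<lambda>s. same_outside_eval s0 s \<and> rarr s 5 0 = G (rarr s0 3))"
proof -
  define y where "y = rarr s0 3"
  define part where "part j = (\<Sum>i<j. c (Ss ! i) * (\<Prod>v\<in>Ss ! i. y v))" for j
  define I where "I j s \<longleftrightarrow> same_outside_eval s0 s \<and> narr s 5 0 = offset j \<and> rarr s 5 0 = part j" for j s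
  \<comment> \<open>The first \<open>q\<close> variables of monomial \<open>j\<close> have been
    multiplied. The cell holding the size accounts for the \<open>Suc\<close> in the reading
    position.\<close>
  define J where "J j q s \<longleftrightarrow> same_outside_eval s0 s \<and> narr s 4 0 = j \<and> narr s 7 0 = card (Ss ! j) \<and>
      narr s 5 0 = Suc (offset j + q) \<and> rarr s 5 0 = part j \<and>
      rarr s 6 0 = c (Ss ! j) * (\<Prod>r<q. y (sorted_list_of_set (Ss ! j) ! r))" for j q s
  have st: "stored s \<and> rarr s 3 = y" if "same_outside_eval s0 s" for s
    using that assms by (auto simp: same_outside_eval_def stored_def y_def)
  have inner: "triple (J j 0)
      (For 6 (nv 7) (RWrite 6 (NConst 0) (RMul (rv 6) (RRead 3 (NRead 1 (nv 5)))) ;;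
         NWrite 5 (NConst 0) (NAdd (nv 5) (NConst 1))))
      (card (Ss ! j) * (3 + 5) + 4) (J j (card (Ss ! j)))" if j: "j < m" for j
  proof (rule triple_For)
    fix q assume q: "q < card (Ss ! j)"
    show "triple (\<lambda>s. J j q s \<and> narr s 6 0 = q)
      (RWrite 6 (NConst 0) (RMul (rv 6) (RRead 3 (NRead 1 (nv 5)))) ;;
         NWrite 5 (NConst 0) (NAdd (nv 5) (NConst 1))) 3
      (\<lambda>s. J j (Suc q) s \<and> narr s 6 0 = q)"
      apply (rule triple_conseq, rule triple_Seq_backward, rule triple_NWrite, rule triple_RWrite)
      subgoal for s
        using st[of s] stored_var[OF _ j q, of s] by (simp add: J_def same_outside_eval_write state_simps)
      by simp
  next
    show "nval (nv 7) s = card (Ss ! j)" if "J j q s" for q s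
      using that by (simp add: J_def)
  next
    show "J j q (nwrite 6 0 x s)" if "J j q s" for q x s
      using that by (simp add: J_def same_outside_eval_write state_simps)
  qed
  let ?body = "RWrite 6 (NConst 0) (RRead 0 (nv 4)) ;;
        NWrite 7 (NConst 0) (NRead 1 (nv 5)) ;;
        NWrite 5 (NConst 0) (NAdd (nv 5) (NConst 1)) ;;
        For 6 (nv 7)
          (RWrite 6 (NConst 0) (RMul (rv 6) (RRead 3 (NRead 1 (nv 5)))) ;;
           NWrite 5 (NConst 0) (NAdd (nv 5) (NConst 1))) ;;
        RWrite 5 (NConst 0) (RAdd (rv 5) (rv 6))"
  have outer: "triple (I 0) (For 4 (NRead 0 (NConst 1)) ?body) (m * ((n * 8 + 12) + 5) + 4) (I m)"
  proof (rule triple_For)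
    fix j assume j: "j < m"
    let ?l = "sorted_list_of_set (Ss ! j)"
    have S: "Ss ! j \<subseteq> {..<n}" "finite (Ss ! j)" using j sub finite_sub by auto
    have "(\<Prod>v\<in>Ss ! j. y v) = (\<Prod>v\<in>set ?l. y v)" using S by simp
    also have "\<dots> = (\<Prod>r<length ?l. y (?l ! r))"
      using bij_betw_nth[of ?l "{..<length ?l}" "set ?l"] by (subst prod.reindex_bij_betw[symmetric]) auto
    finally have pr: "(\<Prod>r<card (Ss ! j). y (?l ! r)) = (\<Prod>v\<in>Ss ! j. y v)"
      by simp
    have after: "triple (J j (card (Ss ! j))) (RWrite 5 (NConst 0) (RAdd (rv 5) (rv 6))) 1
        (\<lambda>s. I (Suc j) s \<and> narr s 4 0 = j)"
      by (rule triple_conseq[OF triple_RWrite])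
        (simp_all add: I_def J_def same_outside_eval_write state_simps offset_Suc[OF j] part_def pr)
    have card: "card (Ss ! j) \<le> n" using card_mono[OF _ S(1)] by simp
    show "triple (\<lambda>s. I j s \<and> narr s 4 0 = j) ?body (n * 8 + 12) (\<lambda>s. I (Suc j) s \<and> narr s 4 0 = j)"
      apply (rule triple_conseq, (rule triple_Seq_backward)+, rule after, rule inner[OF j],
          rule triple_NWrite, rule triple_NWrite, rule triple_RWrite)
      subgoal for s
        using st[of s] stored_size[OF _ j, of s] stored_coeff[OF _ j, of s]
        by (simp add: I_def J_def same_outside_eval_write state_simps)
      using card by simp
  next
    show "nval (NRead 0 (NConst 1)) s = m" if "I j s" for j s
      using that st[of s] stored_m by (auto simp: I_def)
  next
    show "I j (nwrite 4 0 x s)" if "I j s" for j x s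
      using that by (simp add: I_def same_outside_eval_write state_simps)
  qed
  have fin: "triple (I 0) (For 4 (NRead 0 (NConst 1)) ?body) (m * ((n * 8 + 12) + 5) + 4)
      (\<lambda>s. same_outside_eval s0 s \<and> rarr s 5 0 = G (rarr s0 3))"
    by (rule triple_weaken[OF outer]) (simp_all add: I_def part_def G_eq_sum y_def)
  show ?thesis
    unfolding eval_com_def
    apply (rule triple_conseq, (rule triple_Seq_backward)+, rule fin, rule triple_RWrite, rule triple_NWrite)
    subgoal
      using assms by (simp add: I_def same_outside_eval_write state_simps offset_0 part_def same_outside_eval_def)
    by (simp add: eval_time_def)
qed


text \<open>The form with an arbitrary postcondition \<open>Q\<close>, suited to backward
  reasoning.\<close>

lemma triple_eval:
  "triple (\<lambda>s. stored s \<and> (\<forall>s'. same_outside_eval s s' \<and> rarr s' 5 0 = G (rarr s 3) \<longrightarrow> Q s'))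
     eval_com eval_time Q"
  unfolding triple_iff using triple_eval_from by (auto simp: triple_iff)

definition compare_time :: nat where
  "compare_time = 2 * eval_time + 7"

text \<open>Compared with \<open>same_outside_eval\<close>, the real arrays 3 and 7 are released:
  the point changes and the second value is stored.\<close>

definition same_outside_compare :: "state \<Rightarrow> state \<Rightarrow> bool" where
  "same_outside_compare s s' \<longleftrightarrow>
     narr s' 0 = narr s 0 \<and> narr s' 1 = narr s 1 \<and> narr s' 2 = narr s 2 \<and> narr s' 3 = narr s 3 \<and>
     narr s' 8 = narr s 8 \<and> narr s' 9 = narr s 9 \<and>
     rarr s' 0 = rarr s 0 \<and> rarr s' 1 = rarr s 1 \<and> rarr s' 2 = rarr s 2 \<and>
     rarr s' 4 = rarr s 4 \<and> rarr s' 8 = rarr s 8 \<and> rarr s' 9 = rarr s 9"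

lemma triple_compare:
  "triple (\<lambda>s. stored s \<and> (\<forall>s'. same_outside_compare s s' \<and> rarr s' 3 = (rarr s 3)(narr s 3 0 := -1) \<and>
       rarr s' 7 0 = G ((rarr s 3)(narr s 3 0 := 1)) \<and> rarr s' 5 0 = G ((rarr s 3)(narr s 3 0 := -1)) \<longrightarrow> Q s'))
     compare_com compare_time Q"
  unfolding compare_com_def
  apply (rule triple_conseq, (rule triple_Seq_backward)+, rule triple_eval, rule triple_RWrite,
      rule triple_RWrite, rule triple_eval, rule triple_RWrite)
  subgoal for s
    by (simp add: same_outside_eval_def same_outside_compare_def stored_def state_simps)
  by (simp add: compare_time_def)

definition signs_time :: nat where
  "signs_time = n * (compare_time + 16) + 9"

lemma triple_signs:
  assumes "stored s0"
  shows "triple (\<lambda>s. s = s0) signs_com signs_time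
    (\<lambda>s. stored s \<and> narr s 8 = narr s0 8 \<and> rarr s 1 = rarr s0 1 \<and> rarr s 2 = rarr s0 2 \<and> rarr s 8 = rarr s0 8 \<and>
       (\<forall>i<n. rarr s 4 i = grad_sign n c (rarr s0 2) i))"
proof -
  define w where "w = rarr s0 2"
  define K where "K s \<longleftrightarrow> stored s \<and> narr s 8 = narr s0 8 \<and> rarr s 1 = rarr s0 1 \<and> rarr s 2 = w \<and> rarr s 8 = rarr s0 8" for s
  define J where "J i s \<longleftrightarrow> K s \<and> (\<forall>j<i. rarr s 3 j = w j)" for i s
  have copy: "triple (J 0) (For 3 (nv 0) (RWrite 3 (nv 3) (RRead 2 (nv 3)))) (n * (1 + 5) + 4) (J n)"
  proof (rule triple_For)
    fix i assume "i < n"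
    show "triple (\<lambda>s. J i s \<and> narr s 3 0 = i) (RWrite 3 (nv 3) (RRead 2 (nv 3))) 1 (\<lambda>s. J (Suc i) s \<and> narr s 3 0 = i)"
      by (rule triple_conseq[OF triple_RWrite]) (auto simp: J_def K_def stored_def state_simps less_Suc_eq)
  qed (auto simp: J_def K_def stored_def state_simps nth_default_def)
  \<comment> \<open>Each pass overwrites one coordinate of array 3 and restores it from array 2, so
    the next pass again starts from \<open>w\<close>.\<close>
  define I where "I i s \<longleftrightarrow> K s \<and> (\<forall>j<n. rarr s 3 j = w j) \<and> (\<forall>j<i. rarr s 4 j = grad_sign n c w j)" for i s
  have eq: "G (x(i := v)) = G (w(i := v))" if "\<forall>j<n. x j = w j" for x i v
    using that by (intro mlin_cong) auto
  have loop: "triple (I 0) (For 3 (nv 0)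
       (compare_com ;;
        If (RLess (rv 7) (rv 5)) (RWrite 4 (nv 3) (RConst (-1))) (RWrite 4 (nv 3) (RConst 1)) ;;
        RWrite 3 (nv 3) (RRead 2 (nv 3)))) (n * (compare_time + 5 + 5) + 4) (I n)"
  proof (rule triple_For)
    fix i assume "i < n"
    show "triple (\<lambda>s. I i s \<and> narr s 3 0 = i) (compare_com ;;
        If (RLess (rv 7) (rv 5)) (RWrite 4 (nv 3) (RConst (-1))) (RWrite 4 (nv 3) (RConst 1)) ;;
        RWrite 3 (nv 3) (RRead 2 (nv 3))) (compare_time + 5) (\<lambda>s. I (Suc i) s \<and> narr s 3 0 = i)"
      apply (rule triple_conseq, (rule triple_Seq_backward)+, rule triple_RWrite, rule triple_If_backward,
          rule triple_RWrite, rule triple_RWrite, rule triple_compare)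
      subgoal for s
        using eq[of "rarr s 3" i 1] eq[of "rarr s 3" i "-1"]
        by (auto simp: I_def K_def stored_def same_outside_compare_def state_simps grad_sign_def less_Suc_eq)
      by simp
  qed (auto simp: I_def K_def stored_def state_simps nth_default_def)
  have "triple (I 0) (For 3 (nv 0)
       (compare_com ;;
        If (RLess (rv 7) (rv 5)) (RWrite 4 (nv 3) (RConst (-1))) (RWrite 4 (nv 3) (RConst 1)) ;;
        RWrite 3 (nv 3) (RRead 2 (nv 3)))) (n * (compare_time + 5 + 5) + 4)
     (\<lambda>s. stored s \<and> narr s 8 = narr s0 8 \<and> rarr s 1 = rarr s0 1 \<and> rarr s 2 = rarr s0 2 \<and> rarr s 8 = rarr s0 8 \<and>
       (\<forall>i<n. rarr s 4 i = grad_sign n c (rarr s0 2) i))"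
    by (rule triple_weaken[OF loop]) (auto simp: I_def K_def w_def)
  then have loop': "triple (J n) (For 3 (nv 0)
       (compare_com ;;
        If (RLess (rv 7) (rv 5)) (RWrite 4 (nv 3) (RConst (-1))) (RWrite 4 (nv 3) (RConst 1)) ;;
        RWrite 3 (nv 3) (RRead 2 (nv 3)))) (n * (compare_time + 5 + 5) + 4)
     (\<lambda>s. stored s \<and> narr s 8 = narr s0 8 \<and> rarr s 1 = rarr s0 1 \<and> rarr s 2 = rarr s0 2 \<and> rarr s 8 = rarr s0 8 \<and>
       (\<forall>i<n. rarr s 4 i = grad_sign n c (rarr s0 2) i))"
    by (rule triple_conseq) (auto simp: I_def J_def)
  show ?thesis
    unfolding signs_com_def
    by (rule triple_conseq[OF triple_Seq[OF copy loop']])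
      (use assms in \<open>auto simp: J_def K_def w_def signs_time_def add_mult_distrib2\<close>)
qed

definition round_time :: nat where
  "round_time = n * (compare_time + 8) + 4"

lemma triple_round:
  assumes "stored s0" "\<forall>i<n. \<bar>rarr s0 3 i\<bar> \<le> 1"
  shows "triple (\<lambda>s. s = s0) round_com round_time
    (\<lambda>s. stored s \<and> narr s 8 = narr s0 8 \<and> narr s 9 = narr s0 9 \<and> rarr s 1 = rarr s0 1 \<and> rarr s 2 = rarr s0 2 \<and>
       rarr s 4 = rarr s0 4 \<and> rarr s 8 = rarr s0 8 \<and> rarr s 9 = rarr s0 9 \<and>
       (\<forall>i<n. rarr s 3 i \<in> {-1, 1}) \<and> (G (rarr s0 3))\<^sup>2 \<le> (G (rarr s 3))\<^sup>2)"
proof -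
  define I where "I i s \<longleftrightarrow> stored s \<and> narr s 8 = narr s0 8 \<and> narr s 9 = narr s0 9 \<and> rarr s 1 = rarr s0 1 \<and>
      rarr s 2 = rarr s0 2 \<and> rarr s 4 = rarr s0 4 \<and> rarr s 8 = rarr s0 8 \<and> rarr s 9 = rarr s0 9 \<and>
      (\<forall>j<i. rarr s 3 j \<in> {-1, 1}) \<and> (\<forall>j<n. \<bar>rarr s 3 j\<bar> \<le> 1) \<and> (G (rarr s0 3))\<^sup>2 \<le> (G (rarr s 3))\<^sup>2" for i s
  have "triple (I 0) round_com (n * (compare_time + 3 + 5) + 4) (I n)"
    unfolding round_com_def
  proof (rule triple_For)
    fix i assume i: "i < n"
    \<comment> \<open>The better of the two ends is at least as good as the current coordinate; a
      tie goes to -1.\<close>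
    have upd: "(G x)\<^sup>2 \<le> (G (x(i := if (G (x(i := -1)))\<^sup>2 < (G (x(i := 1)))\<^sup>2 then 1 else -1)))\<^sup>2" if "\<forall>j<n. \<bar>x j\<bar> \<le> 1" for x
      using mlin_endpoint[OF i, of x c] that i
      by (auto simp: abs_le_square_iff[symmetric] not_less max_def simp flip: not_le split: if_splits)
    show "triple (\<lambda>s. I i s \<and> narr s 3 0 = i) (compare_com ;;
        If (RLess (RMul (rv 5) (rv 5)) (RMul (rv 7) (rv 7))) (RWrite 3 (nv 3) (RConst 1)) Skip)
        (compare_time + 3) (\<lambda>s. I (Suc i) s \<and> narr s 3 0 = i)"
      apply (rule triple_conseq, (rule triple_Seq_backward)+, rule triple_If_backward,
          rule triple_RWrite, rule triple_Skip, rule triple_compare)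
      subgoal for s
        using upd[of "rarr s 3"]
        by (auto simp: I_def stored_def same_outside_compare_def state_simps less_Suc_eq power2_eq_square
          intro: order.trans split: if_splits)
      by simp
  qed (auto simp: I_def stored_def state_simps nth_default_def)
  then show ?thesis
    by (rule triple_weaken) (use assms in \<open>auto simp: I_def round_time_def\<close>)
qed

text \<open>A square is never -1, so this value can mark the absence of a recorded point.\<close>

definition best_ok :: "state \<Rightarrow> bool" where
  "best_ok s \<longleftrightarrow> rarr s 8 0 = -1 \<or> (\<forall>i<n. rarr s 1 i \<in> {-1, 1}) \<and> rarr s 8 0 = (G (rarr s 1))\<^sup>2"

definition record_time :: nat where
  "record_time = eval_time + n * 6 + 8"

lemma triple_record:
  assumes "stored s0" "best_ok s0" "\<forall>i<n. rarr s0 3 i \<in> {-1, 1}"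
  shows "triple (\<lambda>s. s = s0) record_com record_time
    (\<lambda>s. stored s \<and> best_ok s \<and> narr s 8 = narr s0 8 \<and> narr s 9 = narr s0 9 \<and> rarr s 2 = rarr s0 2 \<and>
       rarr s 4 = rarr s0 4 \<and> rarr s 9 = rarr s0 9 \<and> rarr s0 8 0 \<le> rarr s 8 0 \<and> (G (rarr s0 3))\<^sup>2 \<le> rarr s 8 0)"
    (is "triple _ _ _ ?Q")
proof -
  define y where "y = rarr s0 3"
  \<comment> \<open>While the point is being copied, array 1 does not match scalar 8, so
    \<open>best_ok\<close> is suspended and only restored by the final write to scalar 8.\<close>
  define I where "I i s \<longleftrightarrow> stored s \<and> narr s 8 = narr s0 8 \<and> narr s 9 = narr s0 9 \<and> rarr s 2 = rarr s0 2 \<and>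
      rarr s 4 = rarr s0 4 \<and> rarr s 9 = rarr s0 9 \<and> rarr s 3 = y \<and> rarr s 8 = rarr s0 8 \<and>
      rarr s0 8 0 < (G y)\<^sup>2 \<and> rarr s 5 0 = G y \<and> (\<forall>j<i. rarr s 1 j = y j)" for i s
  have copy: "triple (I 0) (For 3 (nv 0) (RWrite 1 (nv 3) (RRead 3 (nv 3)))) (n * (1 + 5) + 4) (I n)"
  proof (rule triple_For)
    fix i assume "i < n"
    show "triple (\<lambda>s. I i s \<and> narr s 3 0 = i) (RWrite 1 (nv 3) (RRead 3 (nv 3))) 1 (\<lambda>s. I (Suc i) s \<and> narr s 3 0 = i)"
      by (rule triple_conseq[OF triple_RWrite]) (auto simp: I_def stored_def state_simps less_Suc_eq)
  qed (auto simp: I_def stored_def state_simps nth_default_def)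
  have eq: "G x = G y" if "\<forall>j<n. x j = y j" for x
    using that by (intro mlin_cong) auto
  have fin: "triple (I n) (RWrite 8 (NConst 0) (RMul (rv 5) (rv 5))) 1 ?Q"
    apply (rule triple_conseq[OF triple_RWrite])
    subgoal for s
      using assms(3) eq[of "rarr s 1"]
      by (auto simp: I_def stored_def best_ok_def state_simps y_def[symmetric] power2_eq_square)
    by simp
  show ?thesis
    unfolding record_com_def
    apply (rule triple_conseq, rule triple_Seq_backward, rule triple_If_backward, rule triple_Seq[OF copy fin],
        rule triple_Skip, rule triple_eval)
    subgoal for s
      using assms by (auto simp: I_def stored_def best_ok_def same_outside_eval_def y_def power2_eq_square)
    by (simp add: record_time_def)
qed

end

lemma triple_pointwise: "(\<And>s0. P s0 \<Longrightarrow> triple (\<lambda>s. s = s0) c T Q) \<Longrightarrow> triple P c T Q"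
  by (simp add: triple_iff)

lemma qtriple_If_backward:
  assumes "qtriple f1 c T g" "qtriple f2 d T g"
  shows "qtriple (\<lambda>s. if bval b s then f1 s else f2 s) (If b c d) (Suc T) g"
  using assms by (intro qtriple_If; elim qtriple_weaken) auto

lemma qtriple_conseq:
  "qtriple f c T g \<Longrightarrow> (\<And>s. f s \<le> f' s) \<Longrightarrow> T \<le> T' \<Longrightarrow> qtriple f' c T' g"
  by (rule qtriple_weaken) auto

lemma qtriple_Seq_backward: "qtriple g d T' h \<Longrightarrow> qtriple f c T g \<Longrightarrow> qtriple f (c ;; d) (Suc (T + T')) h"
  by (rule qtriple_Seq)

context stored_polynomial
begin

definition search_time :: nat where
  "search_time = (n + 1) * (n * 6 + round_time + record_time + 13) + 6"

text \<open>Half-sized starting coordinates, signs and steps of at most \<open>1 / 2\<close> keep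
  all points in the solid cube, where rounding does not decrease the squared value. The record then
  dominates every point tried.\<close>

lemma triple_search:
  assumes "stored s0" "best_ok s0" "\<forall>i<n. \<bar>rarr s0 2 i\<bar> \<le> 1 / 2" "\<forall>i<n. \<bar>rarr s0 4 i\<bar> \<le> 1"
  shows "triple (\<lambda>s. s = s0) search_com search_time
    (\<lambda>s. stored s \<and> best_ok s \<and> narr s 8 = narr s0 8 \<and> rarr s0 8 0 \<le> rarr s 8 0 \<and>
       (\<forall>j\<le>n. (G (\<lambda>i. rarr s0 2 i + rarr s0 4 i / 2 ^ Suc j))\<^sup>2 \<le> rarr s 8 0))"
proof -
  define y where "y j = (\<lambda>i. rarr s0 2 i + rarr s0 4 i / 2 ^ Suc j)" for j
  define K where "K s \<longleftrightarrow> stored s \<and> best_ok s \<and> narr s 8 = narr s0 8 \<and> rarr s 2 = rarr s0 2 \<and>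
      rarr s 4 = rarr s0 4 \<and> rarr s0 8 0 \<le> rarr s 8 0" for s
  define D where "D j s \<longleftrightarrow> (\<forall>l<j. (G (y l))\<^sup>2 \<le> rarr s 8 0)" for j and s :: state
  define I where "I j s \<longleftrightarrow> K s \<and> D j s \<and> rarr s 9 0 = 1 / 2 ^ Suc j" for j s
  have y1: "\<bar>y j i\<bar> \<le> 1" if "i < n" for i j
  proof -
    have "\<bar>rarr s0 4 i / 2 ^ Suc j\<bar> \<le> 1 / 2 ^ Suc j"
      using assms(4) that by (simp add: abs_divide divide_right_mono)
    also have "\<dots> \<le> 1 / 2 ^ 1"
      by (intro divide_left_mono power_increasing) auto
    finally have "\<bar>rarr s0 4 i / 2 ^ Suc j\<bar> \<le> 1 / 2" by simp
    moreover have "\<bar>rarr s0 2 i\<bar> \<le> 1 / 2" using assms(3) that by simp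
    ultimately show ?thesis unfolding y_def by linarith
  qed
  let ?body = "For 3 (nv 0) (RWrite 3 (nv 3) (RAdd (RRead 2 (nv 3)) (RMul (rv 9) (RRead 4 (nv 3))))) ;;
        round_com ;; record_com ;; RWrite 9 (NConst 0) (RDiv (rv 9) (RConst 2))"
  have "triple (I 0) (For 9 (NAdd (nv 0) (NConst 1)) ?body)
      ((n + 1) * ((n * 6 + round_time + record_time + 8) + 5) + 4) (I (n + 1))"
  proof (rule triple_For)
    fix j assume "j < n + 1"
    define J where "J i s \<longleftrightarrow> I j s \<and> narr s 9 0 = j \<and> (\<forall>l<i. rarr s 3 l = y j l)" for i s
    have copy: "triple (J 0) (For 3 (nv 0) (RWrite 3 (nv 3) (RAdd (RRead 2 (nv 3)) (RMul (rv 9) (RRead 4 (nv 3))))))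
        (n * (1 + 5) + 4) (J n)"
    proof (rule triple_For)
      fix i assume "i < n"
      show "triple (\<lambda>s. J i s \<and> narr s 3 0 = i) (RWrite 3 (nv 3) (RAdd (RRead 2 (nv 3)) (RMul (rv 9) (RRead 4 (nv 3))))) 1
          (\<lambda>s. J (Suc i) s \<and> narr s 3 0 = i)"
        by (rule triple_conseq[OF triple_RWrite])
          (auto simp: J_def I_def K_def D_def y_def stored_def best_ok_def state_simps less_Suc_eq)
    qed (auto simp: J_def I_def K_def D_def stored_def best_ok_def state_simps nth_default_def)
    define R where "R s \<longleftrightarrow> I j s \<and> narr s 9 0 = j \<and> (\<forall>i<n. rarr s 3 i \<in> {-1, 1}) \<and> (G (y j))\<^sup>2 \<le> (G (rarr s 3))\<^sup>2" for s
    have rounded: "triple (J n) round_com round_time R"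
    proof (rule triple_pointwise)
      fix s1 assume J: "J n s1"
      have s1: "stored s1" using J by (auto simp: J_def I_def K_def)
      have b: "\<forall>i<n. \<bar>rarr s1 3 i\<bar> \<le> 1" using J y1 by (auto simp: J_def)
      have "G (rarr s1 3) = G (y j)" using J by (intro mlin_cong) (auto simp: J_def)
      then show "triple (\<lambda>s. s = s1) round_com round_time R"
        by (intro triple_weaken[OF triple_round[OF s1 b]])
          (use J in \<open>auto simp: J_def R_def I_def K_def D_def best_ok_def\<close>)
    qed
    have recorded: "triple R record_com record_time (\<lambda>s. K s \<and> D (Suc j) s \<and> rarr s 9 0 = 1 / 2 ^ Suc j \<and> narr s 9 0 = j)"
    proof (rule triple_pointwise)
      fix s1 assume R: "R s1"
      have s1: "stored s1" "best_ok s1" "\<forall>i<n. rarr s1 3 i \<in> {-1, 1}"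
        using R by (auto simp: R_def I_def K_def)
      show "triple (\<lambda>s. s = s1) record_com record_time (\<lambda>s. K s \<and> D (Suc j) s \<and> rarr s 9 0 = 1 / 2 ^ Suc j \<and> narr s 9 0 = j)"
        by (rule triple_weaken[OF triple_record[OF s1]])
          (use R in \<open>auto simp: R_def I_def K_def D_def less_Suc_eq intro: order.trans\<close>)
    qed
    show "triple (\<lambda>s. I j s \<and> narr s 9 0 = j) ?body (n * 6 + round_time + record_time + 8)
        (\<lambda>s. I (Suc j) s \<and> narr s 9 0 = j)"
      apply (rule triple_conseq, rule triple_Seq_backward, rule triple_Seq_backward, rule triple_Seq_backward,
          rule triple_RWrite, rule triple_weaken[OF recorded _ _ le_refl], assumption)
      subgoal for s
        by (simp add: I_def K_def D_def stored_def best_ok_def state_simps)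
         apply (rule rounded, rule copy)
       apply (simp add: J_def)
      by simp
  qed (auto simp: I_def K_def D_def stored_def best_ok_def state_simps nth_default_def)
  then have loop: "triple (I 0) (For 9 (NAdd (nv 0) (NConst 1)) ?body)
      ((n + 1) * ((n * 6 + round_time + record_time + 8) + 5) + 4)
      (\<lambda>s. stored s \<and> best_ok s \<and> narr s 8 = narr s0 8 \<and> rarr s0 8 0 \<le> rarr s 8 0 \<and>
       (\<forall>j\<le>n. (G (\<lambda>i. rarr s0 2 i + rarr s0 4 i / 2 ^ Suc j))\<^sup>2 \<le> rarr s 8 0))"
    by (rule triple_weaken) (auto simp: I_def K_def D_def y_def less_Suc_eq_le)
  show ?thesis
    unfolding search_com_def
    apply (rule triple_conseq, rule triple_Seq_backward, rule loop, rule triple_RWrite)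
    subgoal for s
      using assms by (auto simp: I_def K_def D_def stored_def best_ok_def state_simps)
    by (simp add: search_time_def)
qed

section \<open>Random starts and repeated trials\<close>

definition start_time :: nat where
  "start_time = n * 9 + 4"

definition valid :: "nat \<Rightarrow> state \<Rightarrow> bool" where
  "valid r s \<longleftrightarrow> stored s \<and> best_ok s \<and> narr s 8 0 = r"

lemma avg_nonneg: "(\<And>x. 0 \<le> f x) \<Longrightarrow> 0 \<le> avg l f y"
  using avg_mono[of "\<lambda>x. 0" f l y] by (simp add: avg_const)

text \<open>Once the coordinates from \<open>l\<close> on are drawn, the expected cost is
  \<open>q\<close> times the conditional probability of a bad start, an average over the remaining
  signs. One coin toss is one unfolding of \<open>avg\<close>.\<close>

lemma qtriple_start:
  fixes t q Q :: real
  assumes q: "0 \<le> q" and Q: "\<And>y. q * avg n (\<lambda>z. if good_start n c t (\<lambda>i. z i / 2) then 0 else 1) y \<le> Q"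
  shows "qtriple (\<lambda>s. if valid r s then (if t\<^sup>2 \<le> rarr s 8 0 then 0 else ennreal Q) else \<infinity>)
    start_com start_time
    (\<lambda>s. if valid r s \<and> (\<forall>i<n. \<bar>rarr s 2 i\<bar> \<le> 1 / 2)
       then (if t\<^sup>2 \<le> rarr s 8 0 \<or> good_start n c t (rarr s 2) then 0 else ennreal q) else \<infinity>)"
proof -
  define bad :: "(nat \<Rightarrow> real) \<Rightarrow> real" where "bad z = (if good_start n c t (\<lambda>i. z i / 2) then 0 else 1)" for z
  \<comment> \<open>The factor 2 turns the stored halves back into signs.\<close>
  define a where "a l s = q * avg l bad (\<lambda>j. 2 * rarr s 2 j)" for l and s :: state
  define V where "V l s \<longleftrightarrow> valid r s \<and> (\<forall>j. l \<le> j \<and> j < n \<longrightarrow> \<bar>rarr s 2 j\<bar> \<le> 1 / 2)" for l s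
  define W where "W l s = (if V l s then (if t\<^sup>2 \<le> rarr s 8 0 then 0 else ennreal (a l s)) else \<infinity>)" for l s
  \<comment> \<open>After \<open>i\<close> tosses the downward counter stands at
    \<open>n - i\<close>, the lowest coordinate drawn so far.\<close>
  define F where "F i s = (if narr s 3 0 = n - i then W (n - i) s else \<infinity>)" for i s
  have a0: "0 \<le> a l s" for l s
    unfolding a_def using q by (intro mult_nonneg_nonneg avg_nonneg) (auto simp: bad_def)
  have half: "(W l (rwrite 2 l (-1 / 2) s) + W l (rwrite 2 l (1 / 2) s)) / 2 \<le> W (Suc l) s"
    for l s
  proof (cases "V (Suc l) s")
    case True
    then have V: "V l (rwrite 2 l v s)" if "v = -1/2 \<or> v = 1/2" for v
      using that by (auto simp: V_def valid_def stored_def best_ok_def state_simps Suc_le_eq)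
    have "(\<lambda>j. 2 * ((rarr s 2)(l := v)) j) = (\<lambda>j. 2 * rarr s 2 j)(l := 2 * v)" for v
      by auto
    then have "a (Suc l) s = (a l (rwrite 2 l (-1 / 2) s) + a l (rwrite 2 l (1 / 2) s)) / 2"
      by (simp add: a_def state_simps algebra_simps)
    then show ?thesis
      using True V a0 by (simp add: W_def state_simps flip: ennreal_plus ennreal_numeral add: divide_ennreal)
  qed (simp add: W_def)
  have body: "qtriple (F i)
       (NWrite 3 (NConst 0) (NSub (nv 3) (NConst 1)) ;;
        Flip 2 (NConst 0) ;;
        If (NLess (NConst 0) (nv 2))
          (RWrite 2 (nv 3) (RDiv (RConst 1) (RConst 2)))
          (RWrite 2 (nv 3) (RDiv (RConst (-1)) (RConst 2)))) 6 (F (Suc i))" if i: "i < n" for i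
    apply (rule qtriple_conseq, (rule qtriple_Seq_backward)+, rule qtriple_If_backward,
        rule qtriple_RWrite, rule qtriple_RWrite, rule qtriple_Flip, rule qtriple_NWrite)
    subgoal for s
    proof -
      define l where "l = n - Suc i"
      have l: "n - i = Suc l" using i by (simp add: l_def)
      have W: "W l (rwrite 2 l v (nwrite 2 0 x (nwrite 3 0 y s))) = W l (rwrite 2 l v s)" for v x y
        by (simp add: W_def V_def a_def valid_def stored_def best_ok_def state_simps)
      show ?thesis
      proof (cases "narr s 3 0 = Suc l")
        case True
        have "F (Suc i) (rwrite 2 l v (nwrite 2 0 x (nwrite 3 0 l s))) = W l (rwrite 2 l v s)" for v x
          unfolding F_def l_def[symmetric] W by (simp add: state_simps)
        moreover have "F i s = W (Suc l) s"
          using True by (simp add: F_def l)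
        ultimately show ?thesis
          using half[of l s] True by (simp add: state_simps)
      next
        case False
        then show ?thesis by (simp add: F_def l)
      qed
    qed
    by simp
  have "qtriple (F 0) (While (NLess (NConst 0) (nv 3))
       (NWrite 3 (NConst 0) (NSub (nv 3) (NConst 1)) ;;
        Flip 2 (NConst 0) ;;
        If (NLess (NConst 0) (nv 2))
          (RWrite 2 (nv 3) (RDiv (RConst 1) (RConst 2)))
          (RWrite 2 (nv 3) (RDiv (RConst (-1)) (RConst 2))))) (n * (6 + 3) + 2) (F n)"
    by (rule qtriple_While[where F = F, OF body]) (auto simp: F_def split: if_splits)
  then have loop: "qtriple (F 0) (While (NLess (NConst 0) (nv 3))
       (NWrite 3 (NConst 0) (NSub (nv 3) (NConst 1)) ;;
        Flip 2 (NConst 0) ;;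
        If (NLess (NConst 0) (nv 2))
          (RWrite 2 (nv 3) (RDiv (RConst 1) (RConst 2)))
          (RWrite 2 (nv 3) (RDiv (RConst (-1)) (RConst 2))))) (n * (6 + 3) + 2)
      (\<lambda>s. if valid r s \<and> (\<forall>i<n. \<bar>rarr s 2 i\<bar> \<le> 1 / 2)
       then (if t\<^sup>2 \<le> rarr s 8 0 \<or> good_start n c t (rarr s 2) then 0 else ennreal q) else \<infinity>)"
    by (rule qtriple_weaken) (auto simp: F_def W_def V_def a_def bad_def)
  show ?thesis
    unfolding start_com_def
    apply (rule qtriple_conseq, rule qtriple_Seq_backward, rule loop, rule qtriple_NWrite)
    subgoal for s
      using Q[of "\<lambda>j. 2 * rarr s 2 j"]
      by (auto simp: F_def W_def V_def a_def bad_def[abs_def] valid_def stored_def best_ok_def state_simps nth_default_def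
        intro!: ennreal_leI)
    by (simp add: start_time_def)
qed

definition main_time :: nat where
  "main_time = n * (start_time + signs_time + search_time + 7) + 6"

text \<open>With \<open>n - r\<close> trials left, the weight of failure is
  \<open>(1 - p) ^ (n - r)\<close>, or 0 once the record has reached \<open>t\<^sup>2\<close>. A
  trial never lowers the record, and its coins supply one factor \<open>1 - p\<close>.\<close>

lemma qtriple_main:
  fixes t p :: real
  assumes p: "0 \<le> p" "p \<le> 1" and t: "t \<ge> 1"
    and avg: "\<And>y. avg n (\<lambda>z. if good_start n c t (\<lambda>i. z i / 2) then 0 else 1) y \<le> 1 - p"
  shows "qtriple (\<lambda>s. if stored s then ennreal ((1 - p) ^ n) else \<infinity>) main_com main_time
    (\<lambda>s. if stored s \<and> best_ok s \<and> t\<^sup>2 \<le> rarr s 8 0 then 0 else 1)"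
proof -
  define F where "F r s = (if stored s \<and> best_ok s then (if t\<^sup>2 \<le> rarr s 8 0 then 0 else ennreal ((1 - p) ^ (n - r))) else \<infinity>)"
    for r :: nat and s
  define F' where "F' r q s = (if valid r s then (if t\<^sup>2 \<le> rarr s 8 0 then 0 else ennreal q) else \<infinity>)" for r q s
  \<comment> \<open>After the tosses the trial is deterministic, so ordinary triples from a fixed
    state \<open>s0\<close> suffice.\<close>
  have rest: "qtriple (\<lambda>s. if valid r s \<and> (\<forall>i<n. \<bar>rarr s 2 i\<bar> \<le> 1 / 2)
       then (if t\<^sup>2 \<le> rarr s 8 0 \<or> good_start n c t (rarr s 2) then 0 else ennreal q) else \<infinity>)
     (signs_com ;; search_com) (Suc (signs_time + search_time)) (F' r q)" for r q
  proof (rule qtriple_if_triple)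
    fix s0 assume "(if valid r s0 \<and> (\<forall>i<n. \<bar>rarr s0 2 i\<bar> \<le> 1 / 2)
       then (if t\<^sup>2 \<le> rarr s0 8 0 \<or> good_start n c t (rarr s0 2) then 0 else ennreal q) else \<infinity>) \<noteq> \<infinity>"
    then have s0: "valid r s0" "\<forall>i<n. \<bar>rarr s0 2 i\<bar> \<le> 1 / 2"
      by (auto split: if_splits)
    define w where "w = rarr s0 2"
    have st: "stored s0" using s0 by (simp add: valid_def)
    show "triple (\<lambda>s. s = s0) (signs_com ;; search_com) (Suc (signs_time + search_time))
      (\<lambda>s. F' r q s \<le> (if valid r s0 \<and> (\<forall>i<n. \<bar>rarr s0 2 i\<bar> \<le> 1 / 2)
       then (if t\<^sup>2 \<le> rarr s0 8 0 \<or> good_start n c t (rarr s0 2) then 0 else ennreal q) else \<infinity>))"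
    proof (rule triple_Seq[OF triple_signs[OF st]], rule triple_pointwise)
      fix s1 assume s1: "stored s1 \<and> narr s1 8 = narr s0 8 \<and> rarr s1 1 = rarr s0 1 \<and> rarr s1 2 = rarr s0 2 \<and>
          rarr s1 8 = rarr s0 8 \<and> (\<forall>i<n. rarr s1 4 i = grad_sign n c (rarr s0 2) i)"
      have eq: "G (\<lambda>i. w i + rarr s1 4 i / 2 ^ Suc j) = G (\<lambda>i. w i + grad_sign n c w i / 2 ^ Suc j)" for j
        using s1 by (intro mlin_cong) (auto simp: w_def)
      have "triple (\<lambda>s. s = s1) search_com search_time
        (\<lambda>s. stored s \<and> best_ok s \<and> narr s 8 = narr s1 8 \<and> rarr s1 8 0 \<le> rarr s 8 0 \<and>
          (\<forall>j\<le>n. (G (\<lambda>i. rarr s1 2 i + rarr s1 4 i / 2 ^ Suc j))\<^sup>2 \<le> rarr s 8 0))"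
        using s0 s1 by (intro triple_search) (auto simp: valid_def best_ok_def grad_sign_def)
      then show "triple (\<lambda>s. s = s1) search_com search_time
        (\<lambda>s. F' r q s \<le> (if valid r s0 \<and> (\<forall>i<n. \<bar>rarr s0 2 i\<bar> \<le> 1 / 2)
          then (if t\<^sup>2 \<le> rarr s0 8 0 \<or> good_start n c t (rarr s0 2) then 0 else ennreal q) else \<infinity>))"
      proof (rule triple_weaken)
        fix s assume s: "stored s \<and> best_ok s \<and> narr s 8 = narr s1 8 \<and> rarr s1 8 0 \<le> rarr s 8 0 \<and>
          (\<forall>j\<le>n. (G (\<lambda>i. rarr s1 2 i + rarr s1 4 i / 2 ^ Suc j))\<^sup>2 \<le> rarr s 8 0)"
        have "valid r s" using s s1 s0 by (simp add: valid_def)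
        moreover have "t\<^sup>2 \<le> rarr s 8 0" if "good_start n c t w"
        proof -
          from that obtain j where j: "j \<le> n" "t \<le> \<bar>G (\<lambda>i. w i + grad_sign n c w i / 2 ^ Suc j)\<bar>"
            by (auto simp: good_start_def)
          from j(2) t have "t\<^sup>2 \<le> (G (\<lambda>i. w i + grad_sign n c w i / 2 ^ Suc j))\<^sup>2"
            by (simp add: abs_le_square_iff[symmetric])
          also have "\<dots> \<le> rarr s 8 0"
            using s s1 j(1) eq[of j] by (auto simp: w_def)
          finally show ?thesis .
        qed
        moreover have "t\<^sup>2 \<le> rarr s 8 0" if "t\<^sup>2 \<le> rarr s0 8 0"
          using s s1 that by auto
        ultimately show "F' r q s \<le> (if valid r s0 \<and> (\<forall>i<n. \<bar>rarr s0 2 i\<bar> \<le> 1 / 2)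
          then (if t\<^sup>2 \<le> rarr s0 8 0 \<or> good_start n c t (rarr s0 2) then 0 else ennreal q) else \<infinity>)"
          using s0 by (auto simp: F'_def w_def)
      qed auto
    qed
  qed
  have trial: "qtriple (F' r (q * (1 - p))) (start_com ;; signs_com ;; search_com)
      (start_time + signs_time + search_time + 2) (F' r q)" if "0 \<le> q" for r q
    unfolding F'_def[of r "q * (1 - p)", abs_def]
    apply (rule qtriple_conseq, rule qtriple_Seq_backward, rule rest, rule qtriple_start[OF that])
      apply (rule mult_left_mono[OF avg that])
     apply simp
    apply simp
    done
  have "qtriple (F 0) (For 8 (nv 0) (start_com ;; signs_com ;; search_com))
      (n * ((start_time + signs_time + search_time + 2) + 5) + 4) (F n)"
  proof (rule qtriple_For)
    fix r assume r: "r < n"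
    have "(\<lambda>s. if narr s 8 0 = r then F r s else \<infinity>) = F' r ((1 - p) ^ (n - Suc r) * (1 - p))"
      using r by (auto simp: F_def F'_def valid_def fun_eq_iff Suc_diff_Suc simp flip: power_Suc2)
    moreover have "(\<lambda>s. if narr s 8 0 = r then F (Suc r) s else \<infinity>) = F' r ((1 - p) ^ (n - Suc r))"
      by (auto simp: F_def F'_def valid_def fun_eq_iff)
    ultimately show "qtriple (\<lambda>s. if narr s 8 0 = r then F r s else \<infinity>) (start_com ;; signs_com ;; search_com)
        (start_time + signs_time + search_time + 2) (\<lambda>s. if narr s 8 0 = r then F (Suc r) s else \<infinity>)"
      using p by (simp only:) (rule trial, simp)
  qed (auto simp: F_def stored_def best_ok_def state_simps nth_default_def split: if_splits)
  then have loop: "qtriple (F 0) (For 8 (nv 0) (start_com ;; signs_com ;; search_com))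
      (n * ((start_time + signs_time + search_time + 2) + 5) + 4)
      (\<lambda>s. if stored s \<and> best_ok s \<and> t\<^sup>2 \<le> rarr s 8 0 then 0 else 1)"
    by (rule qtriple_weaken) (auto simp: F_def)
  have neg: "\<not> t\<^sup>2 \<le> -1" using zero_le_power2[of t] by linarith
  show ?thesis
    unfolding main_com_def
    apply (rule qtriple_conseq, rule qtriple_Seq_backward, rule loop, rule qtriple_RWrite)
    subgoal for s
      using neg by (auto simp: F_def stored_def best_ok_def state_simps)
    by (simp add: main_time_def)
qed

section \<open>Polynomial running time\<close>

text \<open>Evaluation costs order \<open>B ^ 2\<close>. The loops over coordinates, step sizes and
  trials each contribute one more factor \<open>B\<close>.\<close>

lemma main_time_le: "main_time \<le> 1000 * (m + n + 1) ^ 5"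
proof -
  define B where "B = m + n + 1"
  have B: "n \<le> B" "m \<le> B" "n + 1 \<le> B" "1 \<le> B" by (auto simp: B_def)
  have pw: "1 \<le> B ^ i" for i
    using B(4) by simp
  have incr: "B ^ i \<le> B ^ j" if "i \<le> j" for i j
    using that B(4) by (rule power_increasing)
  have up: "B * (a * B ^ i) = a * B ^ Suc i" for a i
    by simp
  have e: "eval_time \<le> 33 * B ^ 2"
  proof -
    have "m * (n * 8 + 17) \<le> B * (25 * B)" using B by (intro mult_le_mono) auto
    also have "\<dots> = 25 * B ^ 2" by (simp add: power2_eq_square)
    finally show ?thesis unfolding eval_time_def using pw[of 2] by linarith
  qed
  have c: "compare_time \<le> 73 * B ^ 2"
    unfolding compare_time_def using e pw[of 2] by linarith
  have s: "signs_time \<le> 98 * B ^ 3"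
  proof -
    have "n * (compare_time + 16) \<le> B * (89 * B ^ 2)"
      by (intro mult_le_mono) (use B c pw[of 2] in linarith)+
    also have "\<dots> = 89 * B ^ 3" by (simp only: up) simp
    finally show ?thesis unfolding signs_time_def using pw[of 3] by linarith
  qed
  have r: "round_time \<le> 85 * B ^ 3"
  proof -
    have "n * (compare_time + 8) \<le> B * (81 * B ^ 2)"
      by (intro mult_le_mono) (use B c pw[of 2] in linarith)+
    also have "\<dots> = 81 * B ^ 3" by (simp only: up) simp
    finally show ?thesis unfolding round_time_def using pw[of 3] by linarith
  qed
  have B23: "B ^ 2 \<le> B ^ 3" "B \<le> B ^ 3" "1 \<le> B ^ 3" "B ^ 3 \<le> B ^ 4" "B \<le> B ^ 4" "1 \<le> B ^ 4" "1 \<le> B ^ 5"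
    using incr[of 2 3] incr[of 1 3] incr[of 3 4] incr[of 1 4] pw[of 3] pw[of 4] pw[of 5] by simp_all
  have d: "record_time \<le> 47 * B ^ 3"
    unfolding record_time_def using e B B23 by linarith
  have h: "search_time \<le> 157 * B ^ 4"
  proof -
    have "n * 6 + round_time + record_time + 13 \<le> 151 * B ^ 3" using r d B B23 by linarith
    then have "(n + 1) * (n * 6 + round_time + record_time + 13) \<le> B * (151 * B ^ 3)"
      using B by (intro mult_le_mono) auto
    also have "\<dots> = 151 * B ^ 4" by (simp only: up) simp
    finally show ?thesis unfolding search_time_def using B23 by linarith
  qed
  have "start_time + signs_time + search_time + 7 \<le> 400 * B ^ 4"
    unfolding start_time_def using s h B B23 by linarith
  then have "n * (start_time + signs_time + search_time + 7) \<le> B * (400 * B ^ 4)"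
    using B by (intro mult_le_mono) auto
  also have "\<dots> = 400 * B ^ 5" by (simp only: up) simp
  finally show ?thesis unfolding main_time_def using B23 unfolding B_def by linarith
qed

end

section \<open>Correctness and running time\<close>

lemma stored_input_state:
  assumes "lists_monomials n g Ss"
  shows "stored_polynomial n Ss (fourier_coeff n g)"
    and "stored_polynomial.stored n Ss (fourier_coeff n g) (input_state n g Ss)"
proof -
  show sp: "stored_polynomial n Ss (fourier_coeff n g)"
  proof
    show "distinct Ss" "\<And>S. S \<in> set Ss \<Longrightarrow> S \<subseteq> {..<n}"
      using assms by (auto simp: lists_monomials_def fourier_support_def)
    show "fourier_coeff n g S = 0" if "S \<notin> set Ss" for S
      using that assms fourier_coeff_expansion[of n g]
      by (cases "S \<subseteq> {..<n}") (auto simp: lists_monomials_def fourier_support_def is_multilinear_expansion_def)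
  qed
  show "stored_polynomial.stored n Ss (fourier_coeff n g) (input_state n g Ss)"
    by (simp add: stored_polynomial.stored_def[OF sp] stored_polynomial.code_def[OF sp] input_state_def)
qed

lemma finite_fourier_support: "finite (fourier_support n g)"
  by (rule finite_subset[of _ "Pow {..<n}"]) (auto simp: fourier_support_def)

text \<open>This is why \<open>n + 1\<close> step sizes are enough for interpolation at any
  degree.\<close>

lemma fourier_degree_le_dim: "fourier_degree n g \<le> n"
  unfolding fourier_degree_def using finite_fourier_support[of n g] card_mono[of "{..<n}"]
  by (auto simp: fourier_support_def)

lemma fourier_coeff_above_degree:
  assumes "S \<subseteq> {..<n}" "fourier_degree n g < card S"
  shows "fourier_coeff n g S = 0"
proof (rule ccontr)
  assume "fourier_coeff n g S \<noteq> 0"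
  then have "card S \<le> fourier_degree n g"
    unfolding fourier_degree_def using assms(1) finite_fourier_support[of n g]
    by (intro Max_ge) (auto simp: fourier_support_def)
  then show False using assms(2) by simp
qed

text \<open>The success bound \<open>p = 0\<close> holds for every polynomial and gives the running time.\<close>

lemma main_halts:
  assumes "lists_monomials n g Ss"
  shows "halts_within main_com (input_state n g Ss) (1000 * (card (fourier_support n g) + n + 1) ^ 5)"
proof -
  interpret stored_polynomial n Ss "fourier_coeff n g" by (rule stored_input_state) fact
  have st: "stored (input_state n g Ss)" by (rule stored_input_state) fact
  have m: "length Ss = card (fourier_support n g)"
    using assms by (metis distinct_card lists_monomials_def)
  have "avg n (\<lambda>z. if good_start n (fourier_coeff n g) 1 (\<lambda>i. z i / 2) then 0 else 1) y \<le> avg n (\<lambda>z. 1) y" for y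
    by (rule avg_mono) auto
  then have "qtriple (\<lambda>s. if stored s then ennreal ((1 - 0) ^ n) else \<infinity>) main_com main_time
      (\<lambda>s. if stored s \<and> best_ok s \<and> 1\<^sup>2 \<le> rarr s 8 0 then 0 else 1)"
    by (intro qtriple_main) (auto simp: avg_const)
  then have "halts_within main_com (input_state n g Ss) main_time"
    using st by (auto simp: qtriple_def)
  then show ?thesis
    using halts_within_mono main_time_le m by metis
qed

text \<open>Each of the \<open>n\<close> trials has a good start with probability at least
  \<open>1 / sqrt n\<close>, and a recorded square of at least \<open>t\<^sup>2\<close> belongs to a
  vertex in the output array.\<close>

lemma main_succeeds:
  fixes t :: real
  assumes lists: "lists_monomials n g Ss" and deg: "fourier_degree n g \<le> k"
    and var: "cube_variance n g = 1" and t: "t \<ge> 1" and n: "n > 0"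
    and infl: "\<And>i. i < n \<Longrightarrow> influence n g i \<le> 1 / (1000000 ^ k * t\<^sup>2)"
  shows "1 - (1 - 1 / sqrt n) ^ n \<le> measure_pmf.prob (final_state main_com (input_state n g Ss))
    {s. output_point n s \<in> cube n \<and> t \<le> \<bar>g (output_point n s)\<bar>}"
proof -
  let ?c = "fourier_coeff n g" and ?p = "1 / sqrt n"
  let ?D = "final_state main_com (input_state n g Ss)"
  let ?S = "{s. output_point n s \<in> cube n \<and> t \<le> \<bar>g (output_point n s)\<bar>}"
  interpret stored_polynomial n Ss ?c by (rule stored_input_state) fact
  have st: "stored (input_state n g Ss)" by (rule stored_input_state) fact
  \<comment> \<open>The exact degree, since the given \<open>k\<close> may exceed \<open>n\<close>.
    A smaller exponent only relaxes the influence bound.\<close>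
  define k' where "k' = fourier_degree n g"
  have good: "?p \<le> avg n (\<lambda>z. if good_start n ?c t (\<lambda>i. z i / 2) then 1 else 0) y" for y
  proof (rule good_start_probability[where k = k'])
    show "?c S = 0" if "S \<subseteq> {..<n}" "k' < card S" for S
      using that fourier_coeff_above_degree by (simp add: k'_def)
    show "k' \<le> n" by (simp add: k'_def fourier_degree_le_dim)
    show "1 \<le> (\<Sum>i<n. \<Sum>S | S \<subseteq> {..<n} \<and> i \<in> S. (?c S)\<^sup>2)"
      using cube_variance_le_influences[of n g] var by (simp add: influence_def)
    show "(\<Sum>S | S \<subseteq> {..<n} \<and> i \<in> S. (?c S)\<^sup>2) \<le> 1 / (1000000 ^ k' * t\<^sup>2)" if "i < n" for i
    proof -
      have "1 / (1000000 ^ k * t\<^sup>2) \<le> 1 / (1000000 ^ k' * t\<^sup>2)"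
        using t deg by (intro divide_left_mono mult_right_mono power_increasing) (auto simp: k'_def)
      then show ?thesis using infl[OF that] by (simp add: influence_def)
    qed
  qed fact
  have bad: "avg n (\<lambda>z. if good_start n ?c t (\<lambda>i. z i / 2) then 0 else 1) y \<le> 1 - ?p" for y
  proof -
    have "(\<lambda>z. if good_start n ?c t (\<lambda>i. z i / 2) then 0 else 1 :: real)
        = (\<lambda>z. 1 + (-1) * (if good_start n ?c t (\<lambda>i. z i / 2) then 1 else 0))" by auto
    then have "avg n (\<lambda>z. if good_start n ?c t (\<lambda>i. z i / 2) then 0 else 1) y
        = 1 + (-1) * avg n (\<lambda>z. if good_start n ?c t (\<lambda>i. z i / 2) then 1 else 0) y"
      by (simp only: avg_add avg_cmult avg_const)
    then show ?thesis using good[of y] by simp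
  qed
  have p: "0 \<le> ?p" "?p \<le> 1" using n by auto
  define post :: "state \<Rightarrow> ennreal" where
    "post s = (if stored s \<and> best_ok s \<and> t\<^sup>2 \<le> rarr s 8 0 then 0 else 1)" for s
  have "(\<integral>\<^sup>+s. post s \<partial>?D) \<le> ennreal ((1 - ?p) ^ n)"
    using qtriple_main[OF p t bad] st unfolding qtriple_def post_def[abs_def] by (auto dest: spec[of _ "input_state n g Ss"])
  \<comment> \<open>\<open>post\<close> dominates the indicator of failure, so its expectation
    bounds the failure probability.\<close>
  moreover have "emeasure ?D (- ?S) \<le> (\<integral>\<^sup>+s. post s \<partial>?D)"
  proof -
    have "indicator (- ?S) s \<le> post s" for s
    proof (cases "post s = 0")
      case True
      then have s: "stored s" "best_ok s" "t\<^sup>2 \<le> rarr s 8 0"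
        by (auto simp: post_def split: if_splits)
      \<comment> \<open>The record is not the marker -1, so \<open>best_ok\<close> describes an
        actual vertex.\<close>
      have "\<not> t\<^sup>2 \<le> -1" using zero_le_power2[of t] by linarith
      then have b: "\<forall>i<n. rarr s 1 i \<in> {-1, 1}" "rarr s 8 0 = (G (rarr s 1))\<^sup>2"
        using s(2,3) by (auto simp: best_ok_def)
      have out: "output_point n s \<in> cube n"
        using b(1) by (auto simp: output_point_def cube_def)
      then have "g (output_point n s) = G (output_point n s)"
        using fourier_coeff_expansion[of n g] by (simp add: is_multilinear_expansion_def mlin_def)
      also have "\<dots> = G (rarr s 1)"
        by (intro mlin_cong) (simp add: output_point_def)
      finally have "t\<^sup>2 \<le> (g (output_point n s))\<^sup>2" using s(3) b(2) by simp
      then have "t \<le> \<bar>g (output_point n s)\<bar>"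
        using t by (simp add: abs_le_square_iff[symmetric])
      then show ?thesis using out by simp
    qed (auto simp: post_def split: split_indicator)
    then have "(\<integral>\<^sup>+s. indicator (- ?S) s \<partial>?D) \<le> (\<integral>\<^sup>+s. post s \<partial>?D)"
      by (intro nn_integral_mono)
    then show ?thesis by simp
  qed
  ultimately have "ennreal (measure_pmf.prob ?D (- ?S)) \<le> ennreal ((1 - ?p) ^ n)"
    unfolding measure_pmf.emeasure_eq_measure by (rule order.trans[rotated])
  then have "measure_pmf.prob ?D (- ?S) \<le> (1 - ?p) ^ n"
    using p by (subst (asm) ennreal_le_iff) auto
  moreover have "measure_pmf.prob ?D (- ?S) = 1 - measure_pmf.prob ?D ?S"
    using measure_pmf.prob_compl[of ?S ?D] by (simp add: Compl_eq_Diff_UNIV)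
  ultimately show ?thesis by linarith
qed

text \<open>The left side is at most \<open>exp (- sqrt n)\<close>, which decays faster than any
  power of \<open>n\<close>.\<close>

lemma failure_probability_small: "\<exists>n0>0. \<forall>n\<ge>n0. (1 - 1 / sqrt (real n)) ^ n \<le> 1 / real n ^ c"
proof -
  have "\<forall>\<^sub>F n in sequentially. exp (- sqrt (real n)) \<le> 1 / real n ^ c"
    by real_asymp
  then obtain N where N: "\<And>n. n \<ge> N \<Longrightarrow> exp (- sqrt (real n)) \<le> 1 / real n ^ c"
    by (auto simp: eventually_sequentially)
  have "(1 - 1 / sqrt (real n)) ^ n \<le> 1 / real n ^ c" if "n \<ge> Suc N" for n
  proof -
    have n: "n > 0" using that by simp
    have "(1 - 1 / sqrt (real n)) ^ n \<le> exp (- (1 / sqrt n)) ^ n"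
      using n exp_ge_add_one_self[of "- (1 / sqrt n)"] by (intro power_mono) auto
    also have "\<dots> = exp (- sqrt n)"
      using n by (simp add: exp_of_nat_mult[symmetric] real_div_sqrt)
    also have "\<dots> \<le> 1 / real n ^ c" using N that by simp
    finally show ?thesis .
  qed
  then show ?thesis by (intro exI[of _ "Suc N"]) auto
qed

text \<open>High probability means failure probability at most \<open>1 / n ^ c\<close> for every
  \<open>c\<close>, from a threshold \<open>n0\<close> on that depends on \<open>c\<close>
  alone.\<close>

theorem theorem4p2:
  shows "\<exists>(C::real) (A::com) (d::nat). C > 0 \<and>
    (\<forall>(n::nat) (k::nat) (g :: (nat \<Rightarrow> real) \<Rightarrow> real) (Ss :: nat set list).
       fourier_degree n g \<le> k \<longrightarrow> lists_monomials n g Ss \<longrightarrow>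
       halts A (input_state n g Ss) \<and>
       real (running_time A (input_state n g Ss))
         \<le> real d * (real (card (fourier_support n g)) + real n + exp (real k)) ^ d) \<and>
    (\<forall>c::nat. \<exists>n0::nat. \<forall>n\<ge>n0.
       \<forall>(k::nat) (g :: (nat \<Rightarrow> real) \<Rightarrow> real) (Ss :: nat set list) (t::real).
         fourier_degree n g \<le> k \<longrightarrow> lists_monomials n g Ss \<longrightarrow>
         cube_variance n g = 1 \<longrightarrow> t \<ge> 1 \<longrightarrow>
         (\<forall>i<n. influence n g i \<le> 1 / (C ^ k * t\<^sup>2)) \<longrightarrow>
         measure_pmf.prob (final_state A (input_state n g Ss))
             {s. output_point n s \<in> cube n \<and> \<bar>g (output_point n s)\<bar> \<ge> t}
           \<ge> 1 - 1 / real n ^ c)"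
\<comment> \<open>The number 1000 serves both as factor and as exponent. The proved bound
  \<open>1000 * (m + n + 1) ^ 5\<close> fits under it since \<open>exp k\<close> is at least
  1.\<close>
proof (rule exI[of _ "1000000 :: real"], rule exI[of _ main_com], rule exI[of _ "1000 :: nat"], intro conjI allI impI)
  show "(0 :: real) < 1000000" by simp
next
  fix n k g Ss
  assume lists: "lists_monomials n g Ss"
  from main_halts[OF lists] show "halts main_com (input_state n g Ss)"
    by (auto simp: halts_def)
  let ?m = "card (fourier_support n g)" and ?X = "real (card (fourier_support n g)) + real n + exp (real k)"
  have X: "1 \<le> ?X" by (simp add: add_increasing)
  have "real (running_time main_com (input_state n g Ss)) \<le> real (1000 * (?m + n + 1) ^ 5)"
    using running_time_le[OF main_halts[OF lists]] by (simp only: of_nat_le_iff)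
  also have "\<dots> = 1000 * (real ?m + real n + 1) ^ 5" by (simp add: ac_simps)
  also have "\<dots> \<le> 1000 * ?X ^ 5"
    by (intro mult_left_mono power_mono) auto
  also have "\<dots> \<le> 1000 * ?X ^ 1000"
    using X by (intro mult_left_mono power_increasing) auto
  finally show "real (running_time main_com (input_state n g Ss)) \<le> real 1000 * ?X ^ 1000" by simp
next
  fix c
  obtain n0 where n0: "n0 > 0" "\<And>n. n \<ge> n0 \<Longrightarrow> (1 - 1 / sqrt (real n)) ^ n \<le> 1 / real n ^ c"
    using failure_probability_small by blast
  show "\<exists>n0::nat. \<forall>n\<ge>n0.
       \<forall>(k::nat) (g :: (nat \<Rightarrow> real) \<Rightarrow> real) (Ss :: nat set list) (t::real).
         fourier_degree n g \<le> k \<longrightarrow> lists_monomials n g Ss \<longrightarrow>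
         cube_variance n g = 1 \<longrightarrow> t \<ge> 1 \<longrightarrow>
         (\<forall>i<n. influence n g i \<le> 1 / (1000000 ^ k * t\<^sup>2)) \<longrightarrow>
         measure_pmf.prob (final_state main_com (input_state n g Ss))
             {s. output_point n s \<in> cube n \<and> \<bar>g (output_point n s)\<bar> \<ge> t}
           \<ge> 1 - 1 / real n ^ c"
  proof (intro exI[of _ n0] allI impI)
    fix n k g Ss and t :: real
    assume "n0 \<le> n" "fourier_degree n g \<le> k" "lists_monomials n g Ss" "cube_variance n g = 1" "1 \<le> t"
      "\<forall>i<n. influence n g i \<le> 1 / (1000000 ^ k * t\<^sup>2)"
    then have "1 - (1 - 1 / sqrt n) ^ n \<le> measure_pmf.prob (final_state main_com (input_state n g Ss))
        {s. output_point n s \<in> cube n \<and> t \<le> \<bar>g (output_point n s)\<bar>}"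
      using n0(1) by (intro main_succeeds) auto
    then show "1 - 1 / real n ^ c \<le> measure_pmf.prob (final_state main_com (input_state n g Ss))
        {s. output_point n s \<in> cube n \<and> t \<le> \<bar>g (output_point n s)\<bar>}"
      using n0(2)[OF \<open>n0 \<le> n\<close>] by linarith
  qed
qed


end
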